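(* Let $\mathcal{K}=(S,AP,\mathcal{L},\to)$ be a weighted Kripke structure. For any two states $s,t\in S$, the weighted branching simulation distance $d(s,t)$ is computable.
   Context: A weighted Kripke structure (WKS) is a tuple $\mathcal{K}=(S,AP,\mathcal{L},\to)$ where $S$ is a finite set of states, $AP$ a set of atomic propositions, $\mathcal{L}:S\to\mathcal{P}(AP)$ a labelling function, and $\to\subseteq S\times\mathbb{Q}_{\ge 0}\times S$ a finite transition relation; we write $s\to_w s'$ for $(s,w,s')\in\to$. A transition sequence from $t$ of length $n\ge 0$ is $t=t_0\to_{v_1}t_1\cdots\to_{v_n}t_n$ with accumulated weight $\sum_{i=1}^n v_i$ ($0$ for $n=0$). Functions $d:S\times S\to[0,\infty]$ are ordered pointwise (a complete lattice). Define $\mathcal{F}$ by $\mathcal{F}(d)(s,t)=\infty$ if $\mathcal{L}(s)\neq\mathcal{L}(t)$, and otherwise \[ \mathcal{F}(d)(s,t)=\max_{s\to_w s'}\ \min_{t\to_{v_1}t_1\cdots\to_{v_n}t_n}\max\Big\{\Big|\tfrac{\sum_{i=1}^n v_i}{w}-1\Big|,\ d(s',t_n),\ \max\{d(s,t_i)\mid 1\le i<n\}\Big\}, \] where the outer max ranges over transitions of $s$, the inner min over all (possibly infinitely many) transition sequences from $t$ (understood as an infimum), and the max of an empty set is $0$. $\mathcal{F}$ is monotone, and the weighted branching simulation distance $d$ is its least fixed point. *)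

theory Defs
  imports "HOL-Analysis.Analysis" "HOL-Library.Nat_Bijection"
begin

section \<open>Weighted Kripke structures\<close>

record ('s, 'p) wks =
  states :: "'s set"
  props :: "'p set"
  label :: "'s \<Rightarrow> 'p set"
  trans :: "('s \<times> rat \<times> 's) set"

definition is_wks :: "('s, 'p) wks \<Rightarrow> bool" where
  "is_wks K \<longleftrightarrow>
     finite (states K) \<and>
     (\<forall>s\<in>states K. label K s \<subseteq> props K) \<and>
     finite (trans K) \<and>
     trans K \<subseteq> states K \<times> {0..} \<times> states K"

text \<open>The sequence from \<open>t = t\<^sub>0\<close> through \<open>t\<^sub>1, \<dots>, t\<^sub>n\<close> with weights \<open>v\<^sub>1, \<dots>, v\<^sub>n\<close> is given
  by \<open>t\<close> and the list \<open>[(v\<^sub>1, t\<^sub>1), \<dots>, (v\<^sub>n, t\<^sub>n)]\<close>.\<close>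

primrec trans_seq :: "('s, 'p) wks \<Rightarrow> 's \<Rightarrow> (rat \<times> 's) list \<Rightarrow> bool" where
  "trans_seq K t [] \<longleftrightarrow> True"
| "trans_seq K t (x # p) \<longleftrightarrow> (t, fst x, snd x) \<in> trans K \<and> trans_seq K (snd x) p"

definition seq_weight :: "(rat \<times> 's) list \<Rightarrow> rat" where
  "seq_weight p = sum_list (map fst p)"

definition seq_end :: "'s \<Rightarrow> (rat \<times> 's) list \<Rightarrow> 's" where
  "seq_end t p = last (t # map snd p)"

text \<open>The states \<open>t\<^sub>i\<close> with \<open>1 \<le> i < n\<close>.\<close>

definition seq_inner :: "(rat \<times> 's) list \<Rightarrow> 's set" where
  "seq_inner p = set (butlast (map snd p))"

section \<open>The weighted branching simulation distance\<close>

text \<open>The relative deviation \<open>\<bar>v / w - 1\<bar>\<close>, for nonnegative \<open>v\<close> and \<open>w\<close>. For \<open>w = 0\<close> we read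
  \<open>0 / 0 = 1\<close> and \<open>v / 0 = \<infinity>\<close> for \<open>v > 0\<close>, so that a zero-weight step is matched exactly
  by zero accumulated weight; HOL's \<open>v / 0 = 0\<close> would yield deviation \<open>1\<close> in all cases.\<close>

definition rel_dev :: "rat \<Rightarrow> rat \<Rightarrow> ennreal" where
  "rel_dev v w =
     (if w = 0 then (if v = 0 then 0 else \<infinity>) else ennreal (of_rat \<bar>v / w - 1\<bar>))"

text \<open>In \<^typ>\<open>ennreal\<close> the supremum of the empty set is \<open>0\<close>, as required here.\<close>

definition wbs_step ::
    "('s, 'p) wks \<Rightarrow> ('s \<Rightarrow> 's \<Rightarrow> ennreal) \<Rightarrow> 's \<Rightarrow> 's \<Rightarrow> ennreal" where
  "wbs_step K d s t =
     (if label K s \<noteq> label K t then \<infinity>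
      else (SUP (w, s') \<in> {(w, s'). (s, w, s') \<in> trans K}.
              INF p \<in> {p. trans_seq K t p}.
                max (rel_dev (seq_weight p) w)
                  (max (d s' (seq_end t p)) (SUP u \<in> seq_inner p. d s u))))"

text \<open>The fixed point is taken over functions on the whole type. Transitions do not leave
  \<^term>\<open>states K\<close>, so on pairs of states it agrees with the fixed point over functions on
  \<^term>\<open>states K \<times> states K\<close>.\<close>

definition wbs_dist :: "('s, 'p) wks \<Rightarrow> 's \<Rightarrow> 's \<Rightarrow> ennreal" where
  "wbs_dist K = lfp (wbs_step K)"

lemma mono_wbs_step: "mono (wbs_step K)"
proof (rule monoI)
  fix d e :: "'a \<Rightarrow> 'a \<Rightarrow> ennreal"
  assume "d \<le> e"
  then have le: "d s t \<le> e s t" for s t by (simp add: le_fun_def)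
  show "wbs_step K d \<le> wbs_step K e"
    unfolding le_fun_def wbs_step_def
    by (auto intro!: SUP_mono' INF_mono' max.mono le)
qed

lemma wbs_dist_unfold: "wbs_dist K = wbs_step K (wbs_dist K)"
  unfolding wbs_dist_def by (rule lfp_unfold[OF mono_wbs_step])

section \<open>Computability\<close>

text \<open>\<^term>\<open>recursive k f\<close>: on argument lists of length \<open>k\<close>, \<open>f\<close> is a total (general) recursive
  function. Minimization is applied only to functions having a zero for all parameters.\<close>

inductive recursive :: "nat \<Rightarrow> (nat list \<Rightarrow> nat) \<Rightarrow> bool" where
  zero: "recursive k (\<lambda>xs. 0)"
| suc: "recursive 1 (\<lambda>xs. Suc (xs ! 0))"
| proj: "i < k \<Longrightarrow> recursive k (\<lambda>xs. xs ! i)"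
| comp: "recursive (length gs) f \<Longrightarrow> (\<forall>g\<in>set gs. recursive k g) \<Longrightarrow>
    recursive k (\<lambda>xs. f (map (\<lambda>g. g xs) gs))"
| prim: "recursive k f \<Longrightarrow> recursive (Suc (Suc k)) g \<Longrightarrow>
    recursive (Suc k) (\<lambda>xs. rec_nat (f (tl xs)) (\<lambda>n r. g (n # r # tl xs)) (hd xs))"
| mu: "recursive (Suc k) f \<Longrightarrow> (\<forall>xs. length xs = k \<longrightarrow> (\<exists>n. f (n # xs) = 0)) \<Longrightarrow>
    recursive k (\<lambda>xs. LEAST n. f (n # xs) = 0)"

section \<open>Finite presentations\<close>

text \<open>A structure is presented by an enumeration \<open>xs\<close> of its states, a list \<open>ls\<close> of numbers
  naming their label sets, and a list \<open>ts\<close> of transitions, in which \<open>(i, a, b, j)\<close> stands for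
  the transition from \<open>xs ! i\<close> to \<open>xs ! j\<close> with weight \<open>a / (b + 1)\<close>. Since label sets
  may be infinite, their names are arbitrary, subject only to equal names meaning
  equal label sets. For finite sets of natural numbers, \<^const>\<open>set_encode\<close> is one such naming.\<close>

definition presents ::
    "'s list \<Rightarrow> nat list \<Rightarrow> (nat \<times> nat \<times> nat \<times> nat) list \<Rightarrow> ('s, 'p) wks \<Rightarrow> bool" where
  "presents xs ls ts K \<longleftrightarrow>
     distinct xs \<and> set xs = states K \<and>
     length ls = length xs \<and>
     (\<forall>i<length xs. \<forall>j<length xs.
        ls ! i = ls ! j \<longleftrightarrow> label K (xs ! i) = label K (xs ! j)) \<and>
     (\<forall>(i, a, b, j)\<in>set ts. i < length xs \<and> j < length xs) \<and>
     trans K = (\<lambda>(i, a, b, j). (xs ! i, of_nat a / of_nat (Suc b), xs ! j)) ` set ts"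

definition wks_code :: "nat list \<Rightarrow> (nat \<times> nat \<times> nat \<times> nat) list \<Rightarrow> nat" where
  "wks_code ls ts =
     prod_encode (list_encode ls,
       list_encode (map (\<lambda>(i, a, b, j).
         prod_encode (i, prod_encode (a, prod_encode (b, j)))) ts))"

text \<open>Every nonnegative rational has many codes; none is preferred.\<close>

definition code_value :: "nat \<Rightarrow> ennreal" where
  "code_value c =
     (case c of 0 \<Rightarrow> \<infinity>
      | Suc m \<Rightarrow> (case prod_decode m of (a, b) \<Rightarrow> ennreal (real a / real (Suc b))))"

lemma ex_presents:
  assumes "is_wks K"
  shows "\<exists>xs ls ts. presents xs ls ts K"
proof -
  from assms have fin: "finite (states K)" "finite (trans K)"
    and sub: "trans K \<subseteq> states K \<times> {0..} \<times> states K"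
    by (auto simp: is_wks_def)
  obtain xs where xs: "distinct xs" "set xs = states K"
    using finite_distinct_list[OF fin(1)] by blast
  obtain us where us: "set us = trans K"
    using finite_list[OF fin(2)] by blast
  obtain \<nu> :: "_ \<Rightarrow> nat" where \<nu>: "inj_on \<nu> (label K ` states K)"
    using finite_imp_inj_to_nat_seg[of "label K ` states K"] fin(1) by auto
  let ?w = "\<lambda>(i, a, b, j). (xs ! i, of_nat a / of_nat (Suc b) :: rat, xs ! j)"
  have ex: "\<exists>q. (case q of (i, a, b, j) \<Rightarrow> i < length xs \<and> j < length xs) \<and> ?w q = u"
    if "u \<in> trans K" for u
  proof -
    obtain s w t where u: "u = (s, w, t)" by (cases u)
    with that sub have st: "s \<in> set xs" "t \<in> set xs" and w: "0 \<le> w" using xs by auto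
    from st obtain i j where ij: "i < length xs" "xs ! i = s" "j < length xs" "xs ! j = t"
      by (auto simp: in_set_conv_nth)
    obtain m n where mn: "w = Fract m n" "n > 0" by (cases w)
    with w have "m \<ge> 0" by (simp add: zero_le_Fract_iff)
    then have "w = of_nat (nat m) / of_nat (Suc (nat n - 1))"
      using mn by (simp add: Fract_of_int_quotient)
    then show ?thesis
      using u ij by (intro exI[of _ "(i, nat m, nat n - 1, j)"]) auto
  qed
  then obtain q where q: "\<And>u. u \<in> trans K \<Longrightarrow>
      (case q u of (i, a, b, j) \<Rightarrow> i < length xs \<and> j < length xs) \<and> ?w (q u) = u"
    by metis
  have "presents xs (map (\<lambda>s. \<nu> (label K s)) xs) (map q us) K"
    unfolding presents_def
  proof (intro conjI)
    show "trans K = ?w ` set (map q us)"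
      using q us by (simp add: image_image)
    show "\<forall>(i, a, b, j)\<in>set (map q us). i < length xs \<and> j < length xs"
      using q us by (auto split: prod.splits)
    show "\<forall>i<length xs. \<forall>j<length xs.
        map (\<lambda>s. \<nu> (label K s)) xs ! i = map (\<lambda>s. \<nu> (label K s)) xs ! j \<longleftrightarrow>
        label K (xs ! i) = label K (xs ! j)"
      using \<nu> xs(2) by (auto simp: inj_on_def dest: nth_mem)
  qed (use xs in auto)
  then show ?thesis by blast
qed

end

theory Submission
  imports Defs
begin

text \<open>Let \<open>D\<close> be a common denominator of all weights, so that they become integers, and let \<open>Q\<close> be a
  common multiple of the positive ones. Then every finite relative deviation is a multiple of
  \<open>1 / Q\<close>, so \<open>R = {(s, t). d(s, t) < (k + 1) / Q}\<close> is a relation all of whose steps are matched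
  within \<open>k / Q\<close> along paths inside \<open>R\<close>. Conversely any such relation yields a pre-fixed point that
  is \<open>k / Q\<close> on \<open>R\<close>. Hence \<open>d(s, t) = k / Q\<close> for the least \<open>k\<close> such that some relation containing
  \<open>(s, t)\<close> matches within \<open>k / Q\<close>, and \<open>d(s, t) = \<infinity>\<close> if there is none.

  For fixed \<open>k\<close> this is decidable: accumulated weights may be capped at a bound depending on \<open>k\<close>, and
  a capped configuration is reachable iff it lies in every set closed under steps; both relations
  and sets of configurations are finite, hence coded by bounded numbers. Whether some \<open>k\<close> works
  is the same question with weights capped at \<open>1\<close>, so the search for the least \<open>k\<close> can be
  guarded and the resulting function is total.\<close>

section \<open>Recursive functions\<close>

text \<open>\<open>recursive\<close> fixes a function on lists of every length; here only its values
  on lists of length \<open>k\<close> count, so functions may be rewritten freely.\<close>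

definition computable :: "nat \<Rightarrow> (nat list \<Rightarrow> nat) \<Rightarrow> bool" where
  "computable k f \<longleftrightarrow> (\<exists>g. recursive k g \<and> (\<forall>xs. length xs = k \<longrightarrow> g xs = f xs))"

definition decidable :: "nat \<Rightarrow> (nat list \<Rightarrow> bool) \<Rightarrow> bool" where
  "decidable k P \<longleftrightarrow> computable k (\<lambda>xs. of_bool (P xs))"

section \<open>Closure under composition, primitive recursion and search\<close>

lemma computable_cong:
  assumes "computable k f" "\<And>xs. length xs = k \<Longrightarrow> f xs = g xs"
  shows "computable k g"
  using assms unfolding computable_def by metis

lemma decidable_cong:
  assumes "decidable k P" "\<And>xs. length xs = k \<Longrightarrow> P xs \<longleftrightarrow> Q xs"
  shows "decidable k Q"
  using assms computable_cong unfolding decidable_def by fastforce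

lemma computable_comp:
  assumes f: "computable (length gs) f" and gs: "\<forall>g\<in>set gs. computable k g"
  shows "computable k (\<lambda>xs. f (map (\<lambda>g. g xs) gs))"
proof -
  obtain f' where f': "recursive (length gs) f'" "\<And>xs. length xs = length gs \<Longrightarrow> f' xs = f xs"
    using f unfolding computable_def by blast
  obtain r where r: "\<And>g. g \<in> set gs \<Longrightarrow> recursive k (r g) \<and> (\<forall>xs. length xs = k \<longrightarrow> r g xs = g xs)"
    using gs unfolding computable_def by metis
  have "recursive k (\<lambda>xs. f' (map (\<lambda>g. g xs) (map r gs)))"
    using f'(1) r by (intro recursive.comp) auto
  moreover have "f' (map (\<lambda>g. g xs) (map r gs)) = f (map (\<lambda>g. g xs) gs)" if "length xs = k" for xs
  proof -
    have "map (\<lambda>g. g xs) (map r gs) = map (\<lambda>g. g xs) gs" using r that by simp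
    then show ?thesis by (simp only: f'(2) length_map)
  qed
  ultimately show ?thesis unfolding computable_def by blast
qed

lemma computable_nth: "i < k \<Longrightarrow> computable k (\<lambda>xs. xs ! i)"
  unfolding computable_def by (blast intro: recursive.proj)

lemma computable_comp1:
  assumes "computable 1 (\<lambda>xs. f (xs ! 0))" "computable k a"
  shows "computable k (\<lambda>xs. f (a xs))"
  using computable_comp[of "[a]" "\<lambda>xs. f (xs ! 0)" k] assms by simp

lemma computable_comp2:
  assumes "computable 2 (\<lambda>xs. f (xs ! 0) (xs ! 1))" "computable k a" "computable k b"
  shows "computable k (\<lambda>xs. f (a xs) (b xs))"
  using computable_comp[of "[a, b]" "\<lambda>xs. f (xs ! 0) (xs ! 1)" k] assms
  by (simp add: numeral_2_eq_2)

lemma computable_Suc: "computable k a \<Longrightarrow> computable k (\<lambda>xs. Suc (a xs))"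
  by (rule computable_comp1) (use recursive.suc in \<open>auto simp: computable_def\<close>)

lemma computable_const: "computable k (\<lambda>xs. c)"
proof (induction c)
  case 0
  show ?case using recursive.zero unfolding computable_def by blast
qed (rule computable_Suc)

lemma map_nth_upt: "length xs = k \<Longrightarrow> map (\<lambda>g. g xs) (map (\<lambda>i xs. xs ! i) [0..<k]) = xs"
  using map_nth[of xs] by (simp add: o_def)

text \<open>\<open>prim\<close> recurses on the head of the argument list. Composing it with
  \<open>h\<close> and the \<open>k\<close> projections allows any computable recursion count while
  base and step still see all of \<open>xs\<close>. In the premise on \<open>g\<close>,
  \<open>ys\<close> is \<open>n # r # xs\<close>.\<close>

lemma computable_rec_nat:
  assumes f: "computable k f"
    and g: "computable (Suc (Suc k)) (\<lambda>ys. g (ys ! 0) (ys ! 1) (tl (tl ys)))"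
    and h: "computable k h"
  shows "computable k (\<lambda>xs. rec_nat (f xs) (\<lambda>n r. g n r xs) (h xs))"
proof -
  obtain f' where f': "recursive k f'" "\<And>xs. length xs = k \<Longrightarrow> f' xs = f xs"
    using f unfolding computable_def by blast
  obtain g' where g': "recursive (Suc (Suc k)) g'"
    "\<And>ys. length ys = Suc (Suc k) \<Longrightarrow> g' ys = g (ys ! 0) (ys ! 1) (tl (tl ys))"
    using g unfolding computable_def by blast
  let ?H = "\<lambda>xs. rec_nat (f' (tl xs)) (\<lambda>n r. g' (n # r # tl xs)) (hd xs)"
  let ?gs = "h # map (\<lambda>i xs. xs ! i) [0..<k]"
  have "computable (length ?gs) ?H"
    using recursive.prim[OF f'(1) g'(1)] unfolding computable_def by auto
  then have "computable k (\<lambda>xs. ?H (map (\<lambda>g. g xs) ?gs))"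
    using h by (intro computable_comp) (auto intro: computable_nth)
  then show ?thesis
  proof (rule computable_cong)
    fix xs :: "nat list" assume l: "length xs = k"
    show "?H (map (\<lambda>g. g xs) ?gs) = rec_nat (f xs) (\<lambda>n r. g n r xs) (h xs)"
      using l by (simp only: list.map map_nth_upt[OF l] list.sel f'(2)) (simp add: g'(2))
  qed
qed

lemma computable_LEAST:
  assumes P: "decidable (Suc k) (\<lambda>ys. P (ys ! 0) (tl ys))"
    and ex: "\<And>xs. length xs = k \<Longrightarrow> \<exists>n. P n xs"
  shows "computable k (\<lambda>xs. LEAST n. P n xs)"
proof -
  \<comment> \<open>\<open>mu\<close> searches for a zero, whereas truth is coded by
    \<open>1\<close>: this recursion sends \<open>0\<close> to \<open>1\<close> and every positive
    number to \<open>0\<close>.\<close>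
  have "computable 1 (\<lambda>xs. rec_nat 1 (\<lambda>n r. 0) (xs ! 0))"
    by (intro computable_rec_nat computable_nth computable_const) simp
  then have "computable (Suc k) (\<lambda>ys. rec_nat 1 (\<lambda>n r. 0) (of_bool (P (ys ! 0) (tl ys))))"
    using P unfolding decidable_def by (rule computable_comp1)
  then obtain g where g: "recursive (Suc k) g"
    "\<And>ys. length ys = Suc k \<Longrightarrow> g ys = rec_nat 1 (\<lambda>n r. 0) (of_bool (P (ys ! 0) (tl ys)))"
    unfolding computable_def by blast
  have eq: "g (n # xs) = 0 \<longleftrightarrow> P n xs" if "length xs = k" for n xs
    using g(2)[of "n # xs"] that by simp
  have "recursive k (\<lambda>xs. LEAST n. g (n # xs) = 0)"
    using g(1) ex eq by (intro recursive.mu) auto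
  then show ?thesis
    unfolding computable_def using eq by (intro exI conjI) auto
qed

text \<open>Each binder pushes its variable onto the argument list, so inside a body the outer variables
  are read off iterated tails.\<close>

definition projection :: "nat \<Rightarrow> (nat list \<Rightarrow> nat list) \<Rightarrow> nat \<Rightarrow> bool" where
  "projection k e i \<longleftrightarrow> (\<exists>m. e = drop m \<and> m + i < k)"

lemma projection_id: "i < k \<Longrightarrow> projection k (\<lambda>ys. ys) i"
  by (auto simp: projection_def intro!: exI[of _ 0])

lemma projection_tl: "projection k e (Suc i) \<Longrightarrow> projection k (\<lambda>ys. tl (e ys)) i"
  unfolding projection_def
  by (elim exE conjE, rule_tac x = "Suc m" in exI) (auto simp: drop_Suc tl_drop)

lemma computable_projection:
  assumes "projection k e i"
  shows "computable k (\<lambda>ys. e ys ! i)"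
proof -
  obtain m where m: "e = drop m" "m + i < k"
    using assms unfolding projection_def by blast
  show ?thesis
    by (rule computable_cong[OF computable_nth[OF m(2)]]) (use m in auto)
qed

lemmas computable_vars = computable_projection projection_id projection_tl computable_const

section \<open>Arithmetic functions\<close>

lemma computable_add:
  assumes "computable k a" "computable k b"
  shows "computable k (\<lambda>xs. a xs + b xs)"
proof (rule computable_comp2[OF _ assms])
  have eq: "rec_nat n (\<lambda>_ r. Suc r) m = m + n" for m n by (induction m) auto
  have "computable 2 (\<lambda>xs. rec_nat (xs ! 1) (\<lambda>_ r. Suc r) (xs ! 0))"
    by (intro computable_rec_nat computable_Suc computable_vars) auto
  then show "computable 2 (\<lambda>xs. xs ! 0 + xs ! 1)" by (simp add: eq)
qed

lemma computable_mult:
  assumes "computable k a" "computable k b"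
  shows "computable k (\<lambda>xs. a xs * b xs)"
proof (rule computable_comp2[OF _ assms])
  have eq: "rec_nat 0 (\<lambda>_ r. n + r) m = m * n" for m n :: nat by (induction m) auto
  have "computable 2 (\<lambda>xs. rec_nat 0 (\<lambda>_ r. xs ! 1 + r) (xs ! 0))"
    by (intro computable_rec_nat computable_add computable_vars) auto
  then show "computable 2 (\<lambda>xs. xs ! 0 * xs ! 1)" by (simp add: eq)
qed

lemma computable_power:
  assumes "computable k a" "computable k b"
  shows "computable k (\<lambda>xs. a xs ^ b xs)"
proof (rule computable_comp2[OF _ assms])
  have eq: "rec_nat 1 (\<lambda>_ r. n * r) m = n ^ m" for m n :: nat by (induction m) auto
  have "computable 2 (\<lambda>xs. rec_nat 1 (\<lambda>_ r. xs ! 0 * r) (xs ! 1))"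
    by (intro computable_rec_nat computable_mult computable_vars) auto
  then show "computable 2 (\<lambda>xs. xs ! 0 ^ xs ! 1)" by (simp only: eq)
qed

lemma computable_fact:
  assumes "computable k a"
  shows "computable k (\<lambda>xs. fact (a xs))"
proof (rule computable_comp1[OF _ assms])
  have eq: "rec_nat 1 (\<lambda>n r. Suc n * r) m = fact m" for m :: nat by (induction m) auto
  have "computable 1 (\<lambda>xs. rec_nat 1 (\<lambda>n r. Suc n * r) (xs ! 0))"
    by (intro computable_rec_nat computable_mult computable_Suc computable_vars) auto
  then show "computable 1 (\<lambda>xs. fact (xs ! 0))" by (simp only: eq)
qed

lemma computable_diff:
  assumes "computable k a" "computable k b"
  shows "computable k (\<lambda>xs. a xs - b xs)"
proof (rule computable_comp2[OF _ assms])
  have pred: "rec_nat 0 (\<lambda>n _. n) m = m - 1" for m :: nat by (cases m) auto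
  have eq: "rec_nat m (\<lambda>_ r. r - 1) n = m - n" for m n :: nat by (induction n) auto
  have "computable 1 (\<lambda>xs. rec_nat 0 (\<lambda>n _. n) (xs ! 0))"
    by (intro computable_rec_nat computable_vars) auto
  then have pr: "computable 1 (\<lambda>xs. xs ! 0 - 1)" by (simp only: pred)
  have "computable 2 (\<lambda>xs. rec_nat (xs ! 0) (\<lambda>_ r. r - 1) (xs ! 1))"
    by (intro computable_rec_nat computable_comp1[OF pr] computable_vars) auto
  then show "computable 2 (\<lambda>xs. xs ! 0 - xs ! 1)" by (simp only: eq)
qed

section \<open>Decidable predicates and bounded quantifiers\<close>

lemma decidable_less:
  assumes "computable k a" "computable k b"
  shows "decidable k (\<lambda>xs. a xs < b xs)"
proof -
  \<comment> \<open>Truncated subtraction from \<open>1\<close> is negation; applied twice it gives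
    the sign of \<open>b xs - a xs\<close>.\<close>
  have "computable k (\<lambda>xs. 1 - (1 - (b xs - a xs)))"
    by (intro computable_diff computable_const assms)
  then show ?thesis unfolding decidable_def by (rule computable_cong) auto
qed

lemma decidable_not:
  assumes "decidable k P"
  shows "decidable k (\<lambda>xs. \<not> P xs)"
proof -
  have "computable k (\<lambda>xs. 1 - of_bool (P xs))"
    using assms unfolding decidable_def by (intro computable_diff computable_const)
  then show ?thesis unfolding decidable_def by (rule computable_cong) auto
qed

lemma decidable_conj:
  assumes "decidable k P" "decidable k Q"
  shows "decidable k (\<lambda>xs. P xs \<and> Q xs)"
  using computable_mult[of k "\<lambda>xs. of_bool (P xs)" "\<lambda>xs. of_bool (Q xs)"] assms
  unfolding decidable_def by (simp add: of_bool_conj)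

lemma decidable_disj:
  assumes "decidable k P" "decidable k Q"
  shows "decidable k (\<lambda>xs. P xs \<or> Q xs)"
  using decidable_not[OF decidable_conj[OF decidable_not decidable_not], OF assms] by simp

lemma decidable_imp:
  assumes "decidable k P" "decidable k Q"
  shows "decidable k (\<lambda>xs. P xs \<longrightarrow> Q xs)"
  using decidable_disj[OF decidable_not, OF assms] by (simp only: imp_conv_disj)

lemma decidable_le:
  assumes "computable k a" "computable k b"
  shows "decidable k (\<lambda>xs. a xs \<le> b xs)"
  using decidable_not[OF decidable_less, OF assms(2,1)] by (simp add: not_less)

lemma decidable_eq:
  assumes "computable k a" "computable k b"
  shows "decidable k (\<lambda>xs. a xs = b xs)"
  using decidable_conj[OF decidable_le decidable_le, OF assms assms(2,1)] by (simp add: eq_iff)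

lemma computable_if:
  assumes "decidable k P" "computable k a" "computable k b"
  shows "computable k (\<lambda>xs. if P xs then a xs else b xs)"
proof -
  have "computable k (\<lambda>xs. of_bool (P xs) * a xs + (1 - of_bool (P xs)) * b xs)"
    using assms unfolding decidable_def
    by (intro computable_add computable_mult computable_diff computable_const)
  then show ?thesis by (rule computable_cong) auto
qed

text \<open>The truth value of a bounded universal statement is the product of the truth values
  below the bound.\<close>

lemma decidable_all_less:
  assumes "computable k b" "decidable (Suc k) (\<lambda>ys. P (ys ! 0) (tl ys))"
  shows "decidable k (\<lambda>xs. \<forall>n<b xs. P n xs)"
proof -
  have eq: "rec_nat 1 (\<lambda>n r. of_bool (P n xs) * r) m = (of_bool (\<forall>n<m. P n xs) :: nat)" for m xs
    by (induction m) (auto simp: less_Suc_eq)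
  have "computable (Suc k) (\<lambda>ys. of_bool (P (ys ! 0) (tl ys)))"
    using assms(2) unfolding decidable_def .
  \<comment> \<open>The recursion step also receives the accumulator as second argument; composing
    with projections that skip it adapts \<open>P\<close>.\<close>
  then have "computable (Suc (Suc k)) (\<lambda>ys. of_bool (P (ys ! 0) (map (\<lambda>i. ys ! Suc (Suc i)) [0..<k])))"
    using computable_comp[of "(\<lambda>ys. ys ! 0) # map (\<lambda>i ys. ys ! Suc (Suc i)) [0..<k]"
        "\<lambda>ys. of_bool (P (ys ! 0) (tl ys))" "Suc (Suc k)"]
    by (auto simp: o_def computable_nth)
  then have P: "computable (Suc (Suc k)) (\<lambda>ys. of_bool (P (ys ! 0) (tl (tl ys))))"
  proof (rule computable_cong)
    fix ys :: "nat list" assume "length ys = Suc (Suc k)"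
    then have "map (\<lambda>i. ys ! Suc (Suc i)) [0..<k] = tl (tl ys)"
      by (intro nth_equalityI) (auto simp: nth_tl)
    then show "of_bool (P (ys ! 0) (map (\<lambda>i. ys ! Suc (Suc i)) [0..<k])) =
        (of_bool (P (ys ! 0) (tl (tl ys))) :: nat)" by simp
  qed
  have "computable k (\<lambda>xs. rec_nat 1 (\<lambda>n r. of_bool (P n xs) * r) (b xs))"
    by (intro computable_rec_nat computable_mult P computable_vars assms(1)) auto
  then show ?thesis unfolding decidable_def by (simp only: eq)
qed

lemma decidable_ex_less:
  assumes "computable k b" "decidable (Suc k) (\<lambda>ys. P (ys ! 0) (tl ys))"
  shows "decidable k (\<lambda>xs. \<exists>n<b xs. P n xs)"
  using decidable_not[OF decidable_all_less[OF assms(1) decidable_not[OF assms(2)]]] by simp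

lemmas computable_intros =
  computable_Suc computable_add computable_mult computable_power computable_fact computable_diff
  decidable_less decidable_not decidable_conj decidable_disj decidable_imp decidable_le decidable_eq
  computable_if decidable_all_less decidable_ex_less computable_vars

lemma computable_div:
  assumes "computable k a" "computable k b"
  shows "computable k (\<lambda>xs. a xs div b xs)"
proof (rule computable_comp2[OF _ assms])
  \<comment> \<open>The disjunct \<open>n = 0\<close> makes the search total and yields
    \<open>0\<close>, the value of division by zero.\<close>
  have eq: "(LEAST q. n = 0 \<or> m < Suc q * n) = m div n" for m n :: nat
  proof (cases "n = 0")
    case False
    then show ?thesis
      by (intro Least_equality)
        (auto simp: div_less_iff_less_mult[symmetric] simp del: mult_Suc)
  qed auto
  have ex: "\<exists>q. n = 0 \<or> m < Suc q * n" for m n :: nat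
    by (rule exI[of _ m]) (cases n, auto)
  have "computable 2 (\<lambda>xs. LEAST q. xs ! 1 = 0 \<or> xs ! 0 < Suc q * xs ! 1)"
    by (intro computable_LEAST ex computable_intros) auto
  then show "computable 2 (\<lambda>xs. xs ! 0 div xs ! 1)" by (simp only: eq)
qed

section \<open>Pairs and lists as numbers\<close>

lemma computable_prod_encode:
  assumes "computable k a" "computable k b"
  shows "computable k (\<lambda>xs. prod_encode (a xs, b xs))"
  unfolding prod_encode_def triangle_def split
  by (intro computable_intros computable_div assms)

definition pfst :: "nat \<Rightarrow> nat" where "pfst z = fst (prod_decode z)"
definition psnd :: "nat \<Rightarrow> nat" where "psnd z = snd (prod_decode z)"

lemma pfst_prod_encode [simp]: "pfst (prod_encode (a, b)) = a"
  and psnd_prod_encode [simp]: "psnd (prod_encode (a, b)) = b"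
  by (simp_all add: pfst_def psnd_def)

lemma prod_encode_pfst_psnd: "prod_encode (pfst z, psnd z) = z"
  by (simp add: pfst_def psnd_def)

lemma pfst_le: "pfst z \<le> z"
  using le_prod_encode_1[of "pfst z" "psnd z"] by (simp add: prod_encode_pfst_psnd)

lemma psnd_le: "psnd z \<le> z"
  using le_prod_encode_2[of "psnd z" "pfst z"] by (simp add: prod_encode_pfst_psnd)

text \<open>The pairing is inverted by search. The other component is bounded by \<open>z\<close>,
  so the predicate searched for has only a bounded quantifier.\<close>

lemma computable_pfst:
  assumes "computable k a"
  shows "computable k (\<lambda>xs. pfst (a xs))"
proof (rule computable_comp1[OF _ assms])
  have *: "\<exists>b<Suc z. prod_encode (pfst z, b) = z" for z
    using prod_encode_pfst_psnd psnd_le by (auto simp: less_Suc_eq_le)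
  then have eq: "(LEAST a. \<exists>b<Suc z. prod_encode (a, b) = z) = pfst z" for z
    by (intro Least_equality) (auto simp del: prod_encode_eq)
  from * have ex: "\<exists>a. \<exists>b<Suc z. prod_encode (a, b) = z" for z by blast
  have "computable 1 (\<lambda>xs. LEAST a. \<exists>b<Suc (xs ! 0). prod_encode (a, b) = xs ! 0)"
    by (rule computable_LEAST[OF _ ex], intro computable_intros computable_prod_encode) auto
  then show "computable 1 (\<lambda>xs. pfst (xs ! 0))" by (simp only: eq)
qed

lemma computable_psnd:
  assumes "computable k a"
  shows "computable k (\<lambda>xs. psnd (a xs))"
proof (rule computable_comp1[OF _ assms])
  have *: "\<exists>a<Suc z. prod_encode (a, psnd z) = z" for z
    using prod_encode_pfst_psnd pfst_le by (auto simp: less_Suc_eq_le)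
  then have eq: "(LEAST b. \<exists>a<Suc z. prod_encode (a, b) = z) = psnd z" for z
    by (intro Least_equality) (auto simp del: prod_encode_eq)
  from * have ex: "\<exists>b. \<exists>a<Suc z. prod_encode (a, b) = z" for z by blast
  have "computable 1 (\<lambda>xs. LEAST b. \<exists>a<Suc (xs ! 0). prod_encode (a, b) = xs ! 0)"
    by (rule computable_LEAST[OF _ ex], intro computable_intros computable_prod_encode) auto
  then show "computable 1 (\<lambda>xs. psnd (xs ! 0))" by (simp only: eq)
qed

text \<open>Since \<open>prod_decode 0 = (0, 0)\<close>, the code \<open>0\<close> of the empty list is its own tail.\<close>

definition ldrop :: "nat \<Rightarrow> nat \<Rightarrow> nat" where
  "ldrop m y = rec_nat y (\<lambda>_ r. psnd (r - 1)) m"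

definition lnth :: "nat \<Rightarrow> nat \<Rightarrow> nat" where
  "lnth y m = pfst (ldrop m y - 1)"

lemma ldrop_list_encode: "ldrop m (list_encode zs) = list_encode (drop m zs)"
proof (induction m)
  case (Suc m)
  \<comment> \<open>A nonempty list is coded by the successor of the paired head and tail codes; for
    the empty list, \<open>psnd_le\<close> gives \<open>psnd 0 = 0\<close>.\<close>
  have "psnd (list_encode ws - 1) = list_encode (tl ws)" for ws
    by (cases ws) (use psnd_le[of 0] in auto)
  then show ?case using Suc by (simp add: ldrop_def drop_Suc tl_drop)
qed (simp add: ldrop_def)

lemma ldrop_eq_0_iff: "ldrop m y = 0 \<longleftrightarrow> length (list_decode y) \<le> m"
  using ldrop_list_encode[of m "list_decode y"] list_encode_eq[of "drop m (list_decode y)" "[]"]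
  by simp

lemma lnth_list_encode: "m < length zs \<Longrightarrow> lnth (list_encode zs) m = zs ! m"
  by (simp add: lnth_def ldrop_list_encode Cons_nth_drop_Suc[symmetric])

lemma length_le_list_encode: "length zs \<le> list_encode zs"
proof (induction zs)
  case (Cons z zs)
  then show ?case using le_prod_encode_2[of "list_encode zs" z] by simp
qed simp

lemma ldrop_le: "ldrop m y \<le> y"
proof (induction m)
  case (Suc m)
  then show ?case using psnd_le[of "ldrop m y - 1"] by (simp add: ldrop_def)
qed (simp add: ldrop_def)

lemma lnth_le: "lnth y m \<le> y"
  using pfst_le[of "ldrop m y - 1"] ldrop_le[of m y] by (simp add: lnth_def)

lemma computable_ldrop:
  assumes "computable k a" "computable k b"
  shows "computable k (\<lambda>xs. ldrop (a xs) (b xs))"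
  by (rule computable_comp2[OF _ assms], unfold ldrop_def)
    (intro computable_rec_nat computable_intros computable_psnd, simp_all)

lemma computable_lnth:
  assumes "computable k a" "computable k b"
  shows "computable k (\<lambda>xs. lnth (a xs) (b xs))"
  unfolding lnth_def by (intro computable_intros computable_pfst computable_ldrop assms)

section \<open>Finite relations as bit sets of numbers\<close>

definition holds :: "nat \<Rightarrow> nat \<Rightarrow> nat \<Rightarrow> bool" where
  "holds z a b \<longleftrightarrow> prod_encode (a, b) \<in> set_decode z"

lemma decidable_holds:
  assumes "computable k c" "computable k a" "computable k b"
  shows "decidable k (\<lambda>xs. holds (c xs) (a xs) (b xs))"
proof -
  \<comment> \<open>Membership in \<open>set_decode\<close> is oddness of a quotient, and a number
    is odd iff halving and doubling changes it.\<close>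
  have "decidable k (\<lambda>xs. 2 * (c xs div 2 ^ prod_encode (a xs, b xs) div 2) \<noteq>
      c xs div 2 ^ prod_encode (a xs, b xs))"
    by (intro computable_intros computable_div computable_prod_encode assms)
  then show ?thesis
    unfolding holds_def set_decode_def mem_Collect_eq
    by (rule decidable_cong) (metis even_two_times_div_two dvd_triv_left)
qed

lemma prod_encode_less:
  assumes "a < m" "b < n"
  shows "prod_encode (a, b) < (m + n)\<^sup>2"
proof -
  have "triangle c \<le> c * c" for c by (induction c) auto
  then have "prod_encode (a, b) \<le> (a + b) * (a + b) + a"
    by (auto simp: prod_encode_def)
  also have "\<dots> < Suc (a + b) * Suc (a + b)" by simp
  also have "\<dots> \<le> (m + n) * (m + n)" using assms by (intro mult_mono) auto
  finally show ?thesis by (simp add: power2_eq_square)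
qed

text \<open>All pairs of the box have codes below \<open>(m + n)\<^sup>2\<close>, so a relation
  inside it is a number with at most that many bits. Quantifiers over relations thereby become
  bounded.\<close>

lemma ex_holds:
  assumes "S \<subseteq> {..<m} \<times> {..<n}"
  shows "\<exists>z<2 ^ (m + n)\<^sup>2. \<forall>a b. holds z a b \<longleftrightarrow> (a, b) \<in> S"
proof (intro exI conjI allI)
  have fin: "finite (prod_encode ` S)"
    using assms finite_subset by blast
  have "prod_encode ` S \<subseteq> {..<(m + n)\<^sup>2}"
    using assms prod_encode_less by auto
  then have "set_encode (prod_encode ` S) \<le> set_encode {..<(m + n)\<^sup>2}"
    unfolding set_encode_def by (intro sum_mono2) auto
  also have "\<dots> < 2 ^ (m + n)\<^sup>2"
    unfolding set_encode_def lessThan_def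
    by (subst mask_eq_sum_exp_nat[symmetric]) simp
  finally show "set_encode (prod_encode ` S) < 2 ^ (m + n)\<^sup>2" .
  fix a b
  show "holds (set_encode (prod_encode ` S)) a b \<longleftrightarrow> (a, b) \<in> S"
    using fin by (simp add: holds_def inj_image_mem_iff[OF inj_prod_encode])
qed

section \<open>Simulations of integer-weighted graphs\<close>

text \<open>One of the two truncated differences vanishes, so this is the absolute
  difference.\<close>

definition deviation :: "nat \<Rightarrow> nat \<Rightarrow> nat" where
  "deviation v w = (v - w) + (w - v)"

locale weighted_graph =
  fixes T :: "nat set" and src wt dst :: "nat \<Rightarrow> nat" and lab :: "nat \<Rightarrow> nat" and N :: nat
  assumes finite_T: "finite T"
    and src_less: "m \<in> T \<Longrightarrow> src m < N"
    and dst_less: "m \<in> T \<Longrightarrow> dst m < N"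
begin

text \<open>Membership in \<open>U\<close> is required of each state entered but not of the start,
  as the distance constrains \<open>t\<^sub>i\<close> only for \<open>i \<ge> 1\<close>.\<close>

inductive reach :: "nat set \<Rightarrow> nat \<Rightarrow> nat \<Rightarrow> nat \<Rightarrow> bool" for U t where
  start: "reach U t t 0"
| step: "reach U t (src m) v \<Longrightarrow> m \<in> T \<Longrightarrow> dst m \<in> U \<Longrightarrow> reach U t (dst m) (v + wt m)"

text \<open>The last edge may leave \<open>U\<close>, since the end of a sequence is not among its
  inner states.\<close>

definition path :: "nat set \<Rightarrow> nat \<Rightarrow> nat \<Rightarrow> nat \<Rightarrow> bool" where
  "path U t u v \<longleftrightarrow> (u = t \<and> v = 0) \<or>
     (\<exists>m\<in>T. \<exists>v'. reach U t (src m) v' \<and> u = dst m \<and> v = v' + wt m)"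

text \<open>The inequality is \<open>\<bar>v / w - 1\<bar> \<le> k / Q\<close> with denominators
  cleared; for \<open>w = 0\<close> and \<open>Q > 0\<close> it forces \<open>v = 0\<close>. Inner
  states must be related to \<open>s\<close>.\<close>

definition sim :: "nat \<Rightarrow> nat \<Rightarrow> (nat \<times> nat) set \<Rightarrow> bool" where
  "sim k Q R \<longleftrightarrow> (\<forall>(s, t)\<in>R. lab s = lab t \<and> (\<forall>m\<in>T. src m = s \<longrightarrow>
     (\<exists>u v. path (R `` {s}) t u v \<and> (dst m, u) \<in> R \<and> deviation v (wt m) * Q \<le> k * wt m)))"

text \<open>Capping the accumulated weights at \<open>M\<close> leaves finitely many configurations.\<close>

definition capped_sim :: "nat \<Rightarrow> nat \<Rightarrow> nat \<Rightarrow> (nat \<times> nat) set \<Rightarrow> bool" where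
  "capped_sim M k Q R \<longleftrightarrow> (\<forall>(s, t)\<in>R. lab s = lab t \<and> (\<forall>m\<in>T. src m = s \<longrightarrow>
     (\<exists>u v. path (R `` {s}) t u v \<and> (dst m, u) \<in> R \<and>
       deviation (min v M) (wt m) * Q \<le> k * wt m)))"

lemma reach_less: "reach U t y v \<Longrightarrow> t < N \<Longrightarrow> y < N"
  by (induction rule: reach.induct) (auto simp: dst_less)

text \<open>A weight of at least \<open>M\<close> exceeds \<open>Suc k * wt m\<close>, hence
  deviates from \<open>wt m\<close> by more than \<open>k * wt m\<close>. The inequality thus fails
  both for a weight above \<open>M\<close> and for its capped value.\<close>

lemma sim_iff_capped_sim:
  assumes "Q > 0" and M: "\<And>m. m \<in> T \<Longrightarrow> Suc k * wt m < M"
  shows "sim k Q R \<longleftrightarrow> capped_sim M k Q R"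
proof -
  have "deviation (min v M) w * Q \<le> k * w \<longleftrightarrow> deviation v w * Q \<le> k * w"
    if w: "Suc k * w < M" for v w
  proof (cases "v \<le> M")
    case False
    have *: "\<not> deviation v' w * Q \<le> k * w" if "M \<le> v'" for v'
    proof -
      have "k * w < (v' - w) * 1" using that w by simp
      also have "\<dots> \<le> deviation v' w * Q"
        using \<open>Q > 0\<close> by (intro mult_mono) (auto simp: deviation_def)
      finally show ?thesis by simp
    qed
    then show ?thesis using False by (simp add: min_def)
  qed (simp add: min_def)
  then have "deviation (min v M) (wt m) * Q \<le> k * wt m \<longleftrightarrow> deviation v (wt m) * Q \<le> k * wt m"
    if "m \<in> T" for m v using M[OF that] .
  then show ?thesis
    unfolding sim_def capped_sim_def by (simp cong: ball_cong_simp)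
qed

text \<open>For \<open>w = 0\<close> both sides say \<open>v = 0\<close>. For \<open>w > 0\<close>
  both hold: \<open>k = deviation v w * Q\<close> is a witness, and \<open>0\<close> and
  \<open>1\<close> deviate from \<open>w\<close> by at most \<open>w\<close>.\<close>

lemma deviation_capped_1_iff:
  assumes "Q > 0"
  shows "deviation (min v 1) w * 1 \<le> 1 * w \<longleftrightarrow> (\<exists>k. deviation v w * Q \<le> k * w)"
proof (cases "w = 0")
  case True
  then show ?thesis using assms by (auto simp: deviation_def min_def)
next
  case False
  then have "deviation v w * Q \<le> (deviation v w * Q) * w" by simp
  then have "\<exists>k. deviation v w * Q \<le> k * w" ..
  then show ?thesis using False by (auto simp: deviation_def min_def)
qed

text \<open>The case \<open>M = k = Q = 1\<close> of \<^const>\<open>capped_sim\<close> only asks that a zero weight be matched by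
  a zero weight.\<close>

lemma ex_sim_iff:
  assumes "finite R" "Q > 0"
  shows "(\<exists>k. sim k Q R) \<longleftrightarrow> capped_sim 1 1 1 R"
proof
  assume "\<exists>k. sim k Q R"
  then obtain k where "sim k Q R" ..
  then show "capped_sim 1 1 1 R"
    unfolding sim_def capped_sim_def deviation_capped_1_iff[OF \<open>Q > 0\<close>] by fastforce
next
  assume cap: "capped_sim 1 1 1 R"
  \<comment> \<open>There are finitely many demands, one for each related pair and edge leaving its
    first component, so the largest of their individual bounds serves all.\<close>
  define I where "I = {((s, t), m). (s, t) \<in> R \<and> m \<in> T \<and> src m = s}"
  have "finite I"
    by (rule finite_subset[of _ "R \<times> T"]) (auto simp: I_def assms finite_T)
  define P where "P = (\<lambda>((s, t), m) k. \<exists>u v. path (R `` {s}) t u v \<and> (dst m, u) \<in> R \<and>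
      deviation v (wt m) * Q \<le> k * wt m)"
  have "\<exists>k. P x k" if x: "x \<in> I" for x
  proof -
    obtain s t m where stm: "x = ((s, t), m)" "(s, t) \<in> R" "m \<in> T" "src m = s"
      using x by (auto simp: I_def)
    then obtain u v where uv: "path (R `` {s}) t u v" "(dst m, u) \<in> R"
      "deviation (min v 1) (wt m) * 1 \<le> 1 * wt m"
      using cap unfolding capped_sim_def by blast
    from uv(3) obtain k where "deviation v (wt m) * Q \<le> k * wt m"
      unfolding deviation_capped_1_iff[OF \<open>Q > 0\<close>] ..
    with uv show ?thesis unfolding P_def stm(1) by auto
  qed
  then obtain K where K: "\<And>x. x \<in> I \<Longrightarrow> P x (K x)"
    by metis
  define k where "k = Max (insert 0 (K ` I))"
  have Kk: "K x \<le> k" if "x \<in> I" for x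
    unfolding k_def using that \<open>finite I\<close> by (intro Max_ge) auto
  have "sim k Q R"
    unfolding sim_def
  proof (intro ballI, clarify, intro conjI ballI impI)
    fix s t assume st: "(s, t) \<in> R"
    show "lab s = lab t" using cap st unfolding capped_sim_def by blast
  next
    fix s t m assume st: "(s, t) \<in> R" and m: "m \<in> T" "src m = s"
    then have I: "((s, t), m) \<in> I" using st by (simp add: I_def)
    from K[OF this] obtain u v where uv: "path (R `` {s}) t u v" "(dst m, u) \<in> R"
      "deviation v (wt m) * Q \<le> K ((s, t), m) * wt m" by (auto simp: P_def)
    have "K ((s, t), m) * wt m \<le> k * wt m" using Kk[OF I] by simp
    with uv show "\<exists>u v. path (R `` {s}) t u v \<and> (dst m, u) \<in> R \<and> deviation v (wt m) * Q \<le> k * wt m"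
      by (meson le_trans)
  qed
  then show "\<exists>k. sim k Q R" ..
qed

section \<open>Reachability and simulation by bounded quantifiers\<close>

definition closed_config :: "nat \<Rightarrow> nat \<Rightarrow> nat \<Rightarrow> nat \<Rightarrow> nat \<Rightarrow> nat \<Rightarrow> bool" where
  "closed_config B M R s t X \<longleftrightarrow> holds X t 0 \<and>
     (\<forall>m<B. \<forall>v<Suc M. m \<in> T \<and> holds X (src m) v \<and> holds R s (dst m) \<longrightarrow>
       holds X (dst m) (min (v + wt m) M))"

text \<open>The capped configurations reachable from \<open>(t, 0)\<close> form the least closed
  set: induction puts them into every closed \<open>X\<close>, and they are themselves a closed set
  with a code below the bound.\<close>

lemma reach_iff_closed_config:
  assumes B: "\<And>m. m \<in> T \<Longrightarrow> m < B" and t: "t < N"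
    and R: "\<And>m. m \<in> T \<Longrightarrow> holds R s (dst m) \<longleftrightarrow> dst m \<in> U"
  shows "(\<exists>v0. reach U t y v0 \<and> v = min v0 M) \<longleftrightarrow>
    (\<forall>X<2 ^ (N + Suc M)\<^sup>2. closed_config B M R s t X \<longrightarrow> holds X y v)"
proof
  assume "\<exists>v0. reach U t y v0 \<and> v = min v0 M"
  then obtain v0 where v0: "reach U t y v0" "v = min v0 M" by blast
  have "holds X y (min v0 M)" if X: "closed_config B M R s t X" for X
    using v0(1)
  proof induction
    case start
    then show ?case using X by (simp add: closed_config_def)
  next
    case (step m v)
    \<comment> \<open>Capping before an addition does not change the capped sum, so steps act on
      capped weights alone.\<close>
    have "min (min v M + wt m) M = min (v + wt m) M" by simp
    moreover have "holds X (dst m) (min (min v M + wt m) M)"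
      using X step B[OF step(2)] R[OF step(2)] unfolding closed_config_def
      by (metis less_Suc_eq_le min.cobounded2)
    ultimately show ?case by simp
  qed
  then show "\<forall>X<2 ^ (N + Suc M)\<^sup>2. closed_config B M R s t X \<longrightarrow> holds X y v"
    using v0 by blast
next
  assume all: "\<forall>X<2 ^ (N + Suc M)\<^sup>2. closed_config B M R s t X \<longrightarrow> holds X y v"
  let ?S = "{(y, v). \<exists>v0. reach U t y v0 \<and> v = min v0 M}"
  have "?S \<subseteq> {..<N} \<times> {..<Suc M}"
    using reach_less[OF _ t] by (auto simp: min_def)
  from ex_holds[OF this] obtain X where X: "X < 2 ^ (N + Suc M)\<^sup>2"
    "\<And>a b. holds X a b \<longleftrightarrow> (a, b) \<in> ?S" by blast
  have "closed_config B M R s t X"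
    unfolding closed_config_def X(2)
  proof (intro conjI allI impI)
    show "(t, 0) \<in> ?S" using start by (auto intro!: exI[of _ 0])
    fix m v assume "m \<in> T \<and> (src m, v) \<in> ?S \<and> holds R s (dst m)"
    then obtain v0 where "m \<in> T" "reach U t (src m) v0" "v = min v0 M" "dst m \<in> U"
      using R by auto
    then have "reach U t (dst m) (v0 + wt m)" "min (v + wt m) M = min (v0 + wt m) M"
      by (auto intro: step)
    then show "(dst m, min (v + wt m) M) \<in> ?S" by auto
  qed
  with all X show "\<exists>v0. reach U t y v0 \<and> v = min v0 M" by auto
qed

definition capped_path :: "nat \<Rightarrow> nat \<Rightarrow> nat \<Rightarrow> nat \<Rightarrow> nat \<Rightarrow> nat \<Rightarrow> nat \<Rightarrow> bool" where
  "capped_path B M R s t u v \<longleftrightarrow> (u = t \<and> v = 0) \<or>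
     (\<exists>m<B. \<exists>v'<Suc M. m \<in> T \<and> u = dst m \<and> v = min (v' + wt m) M \<and>
       (\<forall>X<2 ^ (N + Suc M)\<^sup>2. closed_config B M R s t X \<longrightarrow> holds X (src m) v'))"

lemma capped_path_iff:
  assumes "\<And>m. m \<in> T \<Longrightarrow> m < B" "t < N"
    and "\<And>m. m \<in> T \<Longrightarrow> holds R s (dst m) \<longleftrightarrow> dst m \<in> U"
  shows "capped_path B M R s t u v \<longleftrightarrow> (\<exists>v0. path U t u v0 \<and> v = min v0 M)"
proof -
  have eq: "(\<forall>X<2 ^ (N + Suc M)\<^sup>2. closed_config B M R s t X \<longrightarrow> holds X y v) \<longleftrightarrow>
      (\<exists>v0. reach U t y v0 \<and> v = min v0 M)" for y v
    by (rule reach_iff_closed_config[symmetric]) (use assms in auto)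
  have "capped_path B M R s t u v \<longleftrightarrow> (u = t \<and> v = 0) \<or>
     (\<exists>m<B. \<exists>v'<Suc M. m \<in> T \<and> u = dst m \<and> v = min (v' + wt m) M \<and>
       (\<exists>v0. reach U t (src m) v0 \<and> v' = min v0 M))"
    unfolding capped_path_def eq ..
  also have "\<dots> \<longleftrightarrow> (u = t \<and> v = 0) \<or>
      (\<exists>m\<in>T. \<exists>v0. u = dst m \<and> reach U t (src m) v0 \<and> v = min (min v0 M + wt m) M)"
    using assms(1) le_imp_less_Suc[OF min.cobounded2] by blast
  also have "\<dots> \<longleftrightarrow> (u = t \<and> v = 0) \<or>
      (\<exists>m\<in>T. \<exists>v0. u = dst m \<and> reach U t (src m) v0 \<and> v = min (v0 + wt m) M)"
    by (simp add: min_add_distrib_left min.assoc)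
  also have "\<dots> \<longleftrightarrow> (\<exists>v0. path U t u v0 \<and> v = min v0 M)"
    unfolding path_def by auto
  finally show ?thesis .
qed

text \<open>\<open>capped_sim\<close> for some relation on the vertices, with all quantifiers
  bounded so that the decidability rules apply.\<close>

definition decided_sim :: "nat \<Rightarrow> nat \<Rightarrow> nat \<Rightarrow> nat \<Rightarrow> nat \<Rightarrow> nat \<Rightarrow> bool" where
  "decided_sim B M k Q i j \<longleftrightarrow> i < N \<and> j < N \<and>
     (\<exists>R<2 ^ (N + N)\<^sup>2. holds R i j \<and>
       (\<forall>s<N. \<forall>t<N. holds R s t \<longrightarrow> lab s = lab t \<and>
         (\<forall>m<B. m \<in> T \<and> src m = s \<longrightarrow>
           (\<exists>u<N. \<exists>v<Suc M. capped_path B M R s t u v \<and> holds R (dst m) u \<and>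
              deviation v (wt m) * Q \<le> k * wt m))))"

lemma decided_sim_iff:
  assumes B: "\<And>m. m \<in> T \<Longrightarrow> m < B"
  shows "decided_sim B M k Q i j \<longleftrightarrow>
    (\<exists>R. R \<subseteq> {..<N} \<times> {..<N} \<and> (i, j) \<in> R \<and> capped_sim M k Q R)"
proof -
  \<comment> \<open>Agreement of \<open>c\<close> and \<open>R\<close> on pairs below
    \<open>N\<close> suffices, because edges end below \<open>N\<close>; other pairs held by
    \<open>c\<close> are never inspected.\<close>
  have *: "(\<forall>s<N. \<forall>t<N. holds c s t \<longrightarrow> lab s = lab t \<and>
         (\<forall>m<B. m \<in> T \<and> src m = s \<longrightarrow>
           (\<exists>u<N. \<exists>v<Suc M. capped_path B M c s t u v \<and> holds c (dst m) u \<and>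
              deviation v (wt m) * Q \<le> k * wt m))) \<longleftrightarrow> capped_sim M k Q R"
    if R: "R \<subseteq> {..<N} \<times> {..<N}" "\<And>a b. a < N \<Longrightarrow> b < N \<Longrightarrow> holds c a b \<longleftrightarrow> (a, b) \<in> R" for c R
  proof -
    have body: "(\<exists>u<N. \<exists>v<Suc M. capped_path B M c s t u v \<and> holds c (dst m) u \<and>
              deviation v (wt m) * Q \<le> k * wt m) \<longleftrightarrow>
        (\<exists>u v. path (R `` {s}) t u v \<and> (dst m, u) \<in> R \<and> deviation (min v M) (wt m) * Q \<le> k * wt m)"
      if "s < N" "t < N" "m \<in> T" for s t m
    proof -
      have cp: "capped_path B M c s t u v \<longleftrightarrow> (\<exists>v0. path (R `` {s}) t u v0 \<and> v = min v0 M)" for u v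
        using that R(2) by (intro capped_path_iff B) (auto simp: dst_less)
      have h: "holds c (dst m) u \<longleftrightarrow> (dst m, u) \<in> R" if "u < N" for u
        using that R(2) \<open>m \<in> T\<close> by (auto simp: dst_less)
      show ?thesis (is "?L = ?R")
      proof
        assume ?L
        then obtain u v0 where "u < N" "path (R `` {s}) t u v0" "holds c (dst m) u"
          "deviation (min v0 M) (wt m) * Q \<le> k * wt m" unfolding cp by blast
        with h show ?R by blast
      next
        assume ?R
        then obtain u v where uv: "path (R `` {s}) t u v" "(dst m, u) \<in> R"
          "deviation (min v M) (wt m) * Q \<le> k * wt m" by blast
        from uv(1) have "capped_path B M c s t u (min v M)" using cp by blast
        moreover have "u < N" using uv(2) R(1) by auto
        ultimately show ?L using uv h by (meson le_imp_less_Suc min.cobounded2)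
      qed
    qed
    have pairs: "(\<forall>s<N. \<forall>t<N. holds c s t \<longrightarrow> P s t) \<longleftrightarrow> (\<forall>(s, t)\<in>R. P s t)" for P
      using R by auto
    have steps: "(\<forall>m<B. m \<in> T \<and> src m = s \<longrightarrow> P m) \<longleftrightarrow> (\<forall>m\<in>T. src m = s \<longrightarrow> P m)" for P s
      using B by auto
    show ?thesis
      unfolding capped_sim_def steps pairs using R(1)
      by (intro ball_cong refl) (auto simp: body)
  qed
  show ?thesis
  proof
    assume "decided_sim B M k Q i j"
    then obtain c where ij: "i < N" "j < N" "holds c i j" and c: "\<forall>s<N. \<forall>t<N. holds c s t \<longrightarrow> lab s = lab t \<and>
         (\<forall>m<B. m \<in> T \<and> src m = s \<longrightarrow>
           (\<exists>u<N. \<exists>v<Suc M. capped_path B M c s t u v \<and> holds c (dst m) u \<and>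
              deviation v (wt m) * Q \<le> k * wt m))"
      unfolding decided_sim_def by blast
    let ?R = "{(s, t). s < N \<and> t < N \<and> holds c s t}"
    have "capped_sim M k Q ?R" by (rule *[THEN iffD1, OF _ _ c]) auto
    then show "\<exists>R. R \<subseteq> {..<N} \<times> {..<N} \<and> (i, j) \<in> R \<and> capped_sim M k Q R"
      using ij by (intro exI[of _ ?R]) auto
  next
    assume "\<exists>R. R \<subseteq> {..<N} \<times> {..<N} \<and> (i, j) \<in> R \<and> capped_sim M k Q R"
    then obtain R where R: "R \<subseteq> {..<N} \<times> {..<N}" "(i, j) \<in> R" "capped_sim M k Q R" by blast
    from ex_holds[OF R(1)] obtain c where c: "c < 2 ^ (N + N)\<^sup>2"
      "\<And>a b. holds c a b \<longleftrightarrow> (a, b) \<in> R" by blast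
    show "decided_sim B M k Q i j"
      unfolding decided_sim_def
      using R c *[OF R(1), of c] by (intro conjI exI[of _ c]) auto
  qed
qed

end

section \<open>The distance as a least simulation threshold\<close>

lemma trans_seq_snoc:
  "trans_seq K t (p @ [e]) \<longleftrightarrow> trans_seq K t p \<and> (seq_end t p, fst e, snd e) \<in> trans K"
  by (induction p arbitrary: t) (auto simp: seq_end_def)

lemma seq_end_Nil [simp]: "seq_end t [] = t"
  and seq_end_snoc [simp]: "seq_end t (p @ [e]) = snd e"
  by (simp_all add: seq_end_def)

lemma seq_weight_Nil [simp]: "seq_weight [] = 0"
  and seq_weight_snoc [simp]: "seq_weight (p @ [e]) = seq_weight p + fst e"
  by (simp_all add: seq_weight_def)

lemma seq_inner_Nil [simp]: "seq_inner [] = {}"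
  and seq_inner_snoc [simp]: "seq_inner (p @ [e]) = snd ` set p"
  by (simp_all add: seq_inner_def)

text \<open>The function that is \<open>r\<close> on \<open>R\<close> and \<open>\<infinity>\<close>
  elsewhere is a pre-fixed point of \<open>wbs_step\<close>, hence lies above the least fixed
  point.\<close>

lemma wbs_dist_le:
  assumes R: "\<And>s t. (s, t) \<in> R \<Longrightarrow> label K s = label K t"
    and R': "\<And>s t w s'. (s, t) \<in> R \<Longrightarrow> (s, w, s') \<in> trans K \<Longrightarrow> \<exists>p. trans_seq K t p \<and>
      rel_dev (seq_weight p) w \<le> r \<and> (s', seq_end t p) \<in> R \<and> (\<forall>u\<in>seq_inner p. (s, u) \<in> R)"
    and st: "(s, t) \<in> R"
  shows "wbs_dist K s t \<le> r"
proof -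
  define d where "d = (\<lambda>s t. if (s, t) \<in> R then r else \<infinity>)"
  have "wbs_step K d s t \<le> d s t" for s t
  proof (cases "(s, t) \<in> R")
    case True
    have "(INF p \<in> {p. trans_seq K t p}. max (rel_dev (seq_weight p) w)
        (max (d s' (seq_end t p)) (SUP u \<in> seq_inner p. d s u))) \<le> r"
      if tr: "(s, w, s') \<in> trans K" for w s'
    proof -
      obtain p where p: "trans_seq K t p" "rel_dev (seq_weight p) w \<le> r" "(s', seq_end t p) \<in> R"
        "\<forall>u\<in>seq_inner p. (s, u) \<in> R"
        using R'[OF True tr] by blast
      show ?thesis
        by (rule INF_lower2[of p]) (use p in \<open>auto simp: d_def intro!: SUP_least\<close>)
    qed
    then show ?thesis
      using R[OF True] True by (auto simp: wbs_step_def d_def intro!: SUP_least)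
  qed (simp add: d_def)
  then have "wbs_dist K \<le> d"
    unfolding wbs_dist_def by (intro lfp_lowerbound) (simp add: le_fun_def)
  then show ?thesis using st by (simp add: le_fun_def d_def) (metis (full_types))
qed

text \<open>One unfolding of the fixed point. An infimum below \<open>r\<close> has a member below
  \<open>r\<close>; with a non-strict bound a matching sequence would require the infimum to be
  attained.\<close>

lemma wbs_dist_less:
  assumes less: "wbs_dist K s t < r"
  shows "label K s = label K t"
    and "(s, w, s') \<in> trans K \<Longrightarrow> \<exists>p. trans_seq K t p \<and> rel_dev (seq_weight p) w < r \<and>
      wbs_dist K s' (seq_end t p) < r \<and> (\<forall>u\<in>seq_inner p. wbs_dist K s u < r)"
proof -
  have less': "wbs_step K (wbs_dist K) s t < r"
    using less by (subst (asm) wbs_dist_unfold)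
  then show lab: "label K s = label K t"
    by (auto simp: wbs_step_def split: if_splits)
  let ?f = "\<lambda>w s' p. max (rel_dev (seq_weight p) w)
    (max (wbs_dist K s' (seq_end t p)) (SUP u \<in> seq_inner p. wbs_dist K s u))"
  assume tr: "(s, w, s') \<in> trans K"
  have "(INF p \<in> {p. trans_seq K t p}. ?f w s' p) \<le> wbs_step K (wbs_dist K) s t"
    using lab tr by (auto simp: wbs_step_def intro!: SUP_upper2[of "(w, s')"])
  with less' have "(INF p \<in> {p. trans_seq K t p}. ?f w s' p) < r" by simp
  then obtain p where p: "trans_seq K t p" "?f w s' p < r"
    by (auto simp: INF_less_iff)
  then have "wbs_dist K s u < r" if "u \<in> seq_inner p" for u
    using that by (auto intro: le_less_trans[OF SUP_upper])
  with p show "\<exists>p. trans_seq K t p \<and> rel_dev (seq_weight p) w < r \<and>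
      wbs_dist K s' (seq_end t p) < r \<and> (\<forall>u\<in>seq_inner p. wbs_dist K s u < r)" by auto
qed

section \<open>Relative deviations of scaled weights\<close>

lemma rel_dev_eq:
  assumes "D > 0" "W > 0"
  shows "rel_dev (of_nat V / of_nat D) (of_nat W / of_nat D) = ennreal (real (deviation V W) / real W)"
proof -
  have "(of_nat V / of_nat D) / (of_nat W / of_nat D) - 1 = ((of_nat V - of_nat W) / of_nat W :: rat)"
    using assms by (simp add: field_simps)
  moreover have "\<bar>(of_nat V - of_nat W) / of_nat W :: rat\<bar> = of_nat (deviation V W) / of_nat W"
    by (cases "V \<le> W") (auto simp: deviation_def of_nat_diff)
  ultimately show ?thesis
    using assms by (simp add: rel_dev_def of_rat_divide)
qed

lemma rel_dev_le_iff:
  assumes "D > 0" "Q > 0"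
  shows "rel_dev (of_nat V / of_nat D) (of_nat W / of_nat D) \<le> ennreal (real k / real Q) \<longleftrightarrow>
    deviation V W * Q \<le> k * W"
proof (cases "W = 0")
  case True
  then show ?thesis
    using assms by (auto simp: rel_dev_def deviation_def top_unique)
next
  case False
  have "real (deviation V W) / real W \<le> real k / real Q \<longleftrightarrow>
      real (deviation V W * Q) \<le> real (k * W)"
    using False assms by (simp add: field_simps)
  then show ?thesis
    using False assms by (simp add: rel_dev_eq ennreal_le_iff del: of_nat_mult)
qed

text \<open>If \<open>W\<close> divides \<open>Q\<close>, the deviation is a multiple of \<open>1 / Q\<close>.\<close>

lemma rel_dev_less_imp:
  assumes "D > 0" "Q > 0" "W > 0 \<Longrightarrow> W dvd Q"
    and less: "rel_dev (of_nat V / of_nat D) (of_nat W / of_nat D) < ennreal (real (Suc k) / real Q)"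
  shows "rel_dev (of_nat V / of_nat D) (of_nat W / of_nat D) \<le> ennreal (real k / real Q)"
proof (cases "W = 0")
  case True
  then show ?thesis using less by (auto simp: rel_dev_def split: if_splits)
next
  case False
  then obtain c where c: "Q = W * c" using assms by (auto elim: dvdE)
  have "real (deviation V W) / real W < real (Suc k) / real Q"
    using less False assms by (simp add: rel_dev_eq ennreal_less_iff del: of_nat_Suc)
  then have "real (deviation V W * Q) < real (Suc k * W)"
    using False assms by (simp add: field_simps)
  \<comment> \<open>Cancelling \<open>W\<close> leaves an inequality between integers, where
    \<open>< Suc k\<close> means \<open>\<le> k\<close>.\<close>
  then have "W * (deviation V W * c) < W * Suc k"
    unfolding of_nat_less_iff by (simp add: c ac_simps)
  then have "deviation V W * c \<le> k" by (simp only: mult_less_cancel1 less_Suc_eq_le)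
  then have "deviation V W * c * W \<le> k * W" by simp
  then have "deviation V W * Q \<le> k * W" by (simp add: c ac_simps)
  then show ?thesis using rel_dev_le_iff assms by blast
qed

text \<open>The vertices below \<open>n\<close> name the states. \<open>N\<close> may be larger,
  since it will be read off a code; vertices from \<open>n\<close> on have no edges.\<close>

locale presented_wks = weighted_graph +
  fixes K :: "('s, 'p) wks" and \<sigma> :: "nat \<Rightarrow> 's" and n D Q :: nat
  assumes inj: "inj_on \<sigma> {..<n}"
    and n_le: "n \<le> N"
    and src_n: "m \<in> T \<Longrightarrow> src m < n"
    and dst_n: "m \<in> T \<Longrightarrow> dst m < n"
    and trans_K: "trans K = (\<lambda>m. (\<sigma> (src m), of_nat (wt m) / of_nat D, \<sigma> (dst m))) ` T"
    and lab_iff: "i < n \<Longrightarrow> j < n \<Longrightarrow> lab i = lab j \<longleftrightarrow> label K (\<sigma> i) = label K (\<sigma> j)"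
    and D_pos: "D > 0"
    and Q_pos: "Q > 0"
    and wt_dvd: "m \<in> T \<Longrightarrow> wt m > 0 \<Longrightarrow> wt m dvd Q"
begin

section \<open>Transition sequences, graph paths and simulations\<close>

lemma \<sigma>_eq_iff: "i < n \<Longrightarrow> j < n \<Longrightarrow> \<sigma> i = \<sigma> j \<longleftrightarrow> i = j"
  using inj by (auto simp: inj_on_def)

lemma reach_imp_seq:
  assumes "reach U t y v" "t < n"
  shows "y < n \<and> (\<exists>p. trans_seq K (\<sigma> t) p \<and> seq_end (\<sigma> t) p = \<sigma> y \<and>
    seq_weight p = of_nat v / of_nat D \<and> snd ` set p \<subseteq> \<sigma> ` (U \<inter> {..<n}))"
  using assms(1)
proof induction
  case start
  then show ?case using assms(2) by (auto intro!: exI[of _ "[]"])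
next
  case (step m v)
  then obtain p where p: "trans_seq K (\<sigma> t) p" "seq_end (\<sigma> t) p = \<sigma> (src m)"
    "seq_weight p = of_nat v / of_nat D" "snd ` set p \<subseteq> \<sigma> ` (U \<inter> {..<n})" by blast
  let ?p = "p @ [(of_nat (wt m) / of_nat D, \<sigma> (dst m))]"
  have "trans_seq K (\<sigma> t) ?p"
    using p step by (auto simp: trans_seq_snoc trans_K)
  moreover have "seq_weight ?p = of_nat (v + wt m) / of_nat D"
    using p by (simp add: add_divide_distrib)
  moreover have "snd ` set ?p \<subseteq> \<sigma> ` (U \<inter> {..<n})"
    using p(4) step dst_n by auto
  ultimately show ?case using dst_n[OF step(2)] by (intro conjI exI[of _ ?p]) auto
qed

lemma path_imp_seq:
  assumes "path U t u v" "t < n"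
  shows "u < n \<and> (\<exists>p. trans_seq K (\<sigma> t) p \<and> seq_end (\<sigma> t) p = \<sigma> u \<and>
    seq_weight p = of_nat v / of_nat D \<and> seq_inner p \<subseteq> \<sigma> ` (U \<inter> {..<n}))"
  using assms(1) unfolding path_def
proof
  assume "u = t \<and> v = 0"
  then show ?thesis using assms(2) by (auto intro!: exI[of _ "[]"])
next
  assume "\<exists>m\<in>T. \<exists>v'. reach U t (src m) v' \<and> u = dst m \<and> v = v' + wt m"
  then obtain m v' where m: "m \<in> T" "reach U t (src m) v'" "u = dst m" "v = v' + wt m" by blast
  from reach_imp_seq[OF m(2) assms(2)] obtain p where p: "trans_seq K (\<sigma> t) p"
    "seq_end (\<sigma> t) p = \<sigma> (src m)" "seq_weight p = of_nat v' / of_nat D"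
    "snd ` set p \<subseteq> \<sigma> ` (U \<inter> {..<n})" by blast
  let ?p = "p @ [(of_nat (wt m) / of_nat D, \<sigma> (dst m))]"
  have "trans_seq K (\<sigma> t) ?p" using p m by (auto simp: trans_seq_snoc trans_K)
  moreover have "seq_weight ?p = of_nat v / of_nat D"
    using p m by (simp add: add_divide_distrib)
  ultimately show ?thesis using p m dst_n by (intro conjI exI[of _ ?p]) auto
qed

lemma seq_imp_reach:
  assumes "trans_seq K (\<sigma> t) p" "t < n" "snd ` set p \<subseteq> \<sigma> ` U" "U \<subseteq> {..<n}"
  shows "\<exists>y<n. \<exists>v. reach U t y v \<and> seq_end (\<sigma> t) p = \<sigma> y \<and> seq_weight p = of_nat v / of_nat D"
  using assms(1,3)
proof (induction p rule: rev_induct)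
  case Nil
  then show ?case using assms(2) start by (intro exI[of _ t] conjI exI[of _ 0]) auto
next
  case (snoc e p)
  then obtain y v where y: "y < n" "reach U t y v" "seq_end (\<sigma> t) p = \<sigma> y"
    "seq_weight p = of_nat v / of_nat D" by (auto simp: trans_seq_snoc)
  from snoc.prems(1) obtain m where m: "m \<in> T" "\<sigma> y = \<sigma> (src m)"
    "fst e = of_nat (wt m) / of_nat D" "snd e = \<sigma> (dst m)"
    by (auto simp: trans_seq_snoc trans_K y)
  have "y = src m" using m y \<sigma>_eq_iff src_n by blast
  moreover have "dst m \<in> U"
  proof -
    from snoc.prems(2) m(4) obtain z where "z \<in> U" "\<sigma> (dst m) = \<sigma> z" by auto
    then show ?thesis using \<sigma>_eq_iff[of "dst m" z] dst_n[OF m(1)] assms(4) by auto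
  qed
  ultimately have "reach U t (dst m) (v + wt m)" using y m by (auto intro: step)
  moreover have "seq_weight (p @ [e]) = of_nat (v + wt m) / of_nat D"
    using y m by (simp add: add_divide_distrib)
  ultimately show ?case using m dst_n[OF m(1)] by (intro exI[of _ "dst m"] conjI exI[of _ "v + wt m"]) auto
qed

text \<open>The last transition is split off: all earlier targets are inner states and lie in
  \<open>U\<close>, so \<open>seq_imp_reach\<close> applies to the rest.\<close>

lemma seq_imp_path:
  assumes "trans_seq K (\<sigma> t) p" "t < n" "seq_inner p \<subseteq> \<sigma> ` U" "U \<subseteq> {..<n}"
  shows "\<exists>u<n. \<exists>v. path U t u v \<and> seq_end (\<sigma> t) p = \<sigma> u \<and> seq_weight p = of_nat v / of_nat D"
proof (cases p rule: rev_cases)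
  case Nil
  then show ?thesis using assms(2) by (intro exI[of _ t] conjI exI[of _ 0]) (auto simp: path_def)
next
  case (snoc q e)
  with assms obtain y v where y: "y < n" "reach U t y v" "seq_end (\<sigma> t) q = \<sigma> y"
    "seq_weight q = of_nat v / of_nat D"
    using seq_imp_reach[of t q U] by (auto simp: trans_seq_snoc)
  from assms(1) snoc obtain m where m: "m \<in> T" "\<sigma> y = \<sigma> (src m)"
    "fst e = of_nat (wt m) / of_nat D" "snd e = \<sigma> (dst m)"
    by (auto simp: trans_seq_snoc trans_K y)
  have "y = src m" using m y \<sigma>_eq_iff src_n by blast
  then have "path U t (dst m) (v + wt m)" using y m by (auto simp: path_def)
  moreover have "seq_weight p = of_nat (v + wt m) / of_nat D"
    using y m by (simp add: snoc add_divide_distrib)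
  ultimately show ?thesis using m dst_n[OF m(1)] snoc by (intro exI[of _ "dst m"] conjI exI[of _ "v + wt m"]) auto
qed

text \<open>The image of \<open>R\<close> under \<open>\<sigma>\<close>, restricted to vertices
  below \<open>n\<close>, satisfies the premises of \<open>wbs_dist_le\<close>; the restriction is
  harmless because edges and paths from such vertices stay below \<open>n\<close>.\<close>

lemma sim_imp_wbs_dist_le:
  assumes sim: "sim k Q R" and ij: "(i, j) \<in> R" "i < n" "j < n"
  shows "wbs_dist K (\<sigma> i) (\<sigma> j) \<le> ennreal (real k / real Q)"
proof (rule wbs_dist_le)
  let ?R = "{(\<sigma> s, \<sigma> t) | s t. (s, t) \<in> R \<and> s < n \<and> t < n}"
  show "(\<sigma> i, \<sigma> j) \<in> ?R" using ij by blast
  show "label K s = label K t" if "(s, t) \<in> ?R" for s t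
    using that sim lab_iff unfolding sim_def by blast
  fix a b w a' assume ab: "(a, b) \<in> ?R" and tr: "(a, w, a') \<in> trans K"
  obtain s t where st: "a = \<sigma> s" "b = \<sigma> t" "(s, t) \<in> R" "s < n" "t < n" using ab by blast
  obtain m where m: "m \<in> T" "\<sigma> s = \<sigma> (src m)" "w = of_nat (wt m) / of_nat D" "a' = \<sigma> (dst m)"
    using tr by (auto simp: trans_K st)
  have "src m = s" using m st \<sigma>_eq_iff src_n by blast
  with sim st m obtain u v where uv: "path (R `` {s}) t u v" "(dst m, u) \<in> R"
    "deviation v (wt m) * Q \<le> k * wt m" unfolding sim_def by blast
  from path_imp_seq[OF uv(1) st(5)] obtain p where p: "u < n" "trans_seq K (\<sigma> t) p"
    "seq_end (\<sigma> t) p = \<sigma> u" "seq_weight p = of_nat v / of_nat D"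
    "seq_inner p \<subseteq> \<sigma> ` (R `` {s} \<inter> {..<n})" by blast
  have "rel_dev (seq_weight p) w \<le> ennreal (real k / real Q)"
    unfolding p(4) m(3) using rel_dev_le_iff[OF D_pos Q_pos] uv(3) by blast
  moreover have "(a', seq_end b p) \<in> ?R"
    using p st m uv dst_n by blast
  moreover have "\<forall>u\<in>seq_inner p. (a, u) \<in> ?R"
    using p(5) st by blast
  ultimately show "\<exists>p. trans_seq K b p \<and> rel_dev (seq_weight p) w \<le> ennreal (real k / real Q) \<and>
      (a', seq_end b p) \<in> ?R \<and> (\<forall>u\<in>seq_inner p. (a, u) \<in> ?R)"
    using p(2) st(2) by blast
qed

text \<open>The pairs at distance below \<open>Suc k / Q\<close> form the simulation. Their steps
  are matched with deviation below \<open>Suc k / Q\<close>, hence at most \<open>k / Q\<close> by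
  discreteness.\<close>

lemma wbs_dist_less_imp_sim:
  assumes less: "wbs_dist K (\<sigma> i) (\<sigma> j) < ennreal (real (Suc k) / real Q)"
    and ij: "i < n" "j < n"
  shows "\<exists>R. R \<subseteq> {..<N} \<times> {..<N} \<and> (i, j) \<in> R \<and> sim k Q R"
proof -
  define r where "r = ennreal (real (Suc k) / real Q)"
  define R where "R = {(s, t). s < n \<and> t < n \<and> wbs_dist K (\<sigma> s) (\<sigma> t) < r}"
  have "sim k Q R"
    unfolding sim_def
  proof (intro ballI, clarify, intro conjI ballI impI)
    fix s t assume st: "(s, t) \<in> R"
    then show "lab s = lab t"
      using lab_iff[of s t] wbs_dist_less(1)[of K "\<sigma> s" "\<sigma> t" r] by (simp add: R_def)
  next
    fix s t m assume st: "(s, t) \<in> R" and m: "m \<in> T" "src m = s"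
    have st': "s < n" "t < n" "wbs_dist K (\<sigma> s) (\<sigma> t) < r" using st by (auto simp: R_def)
    have "(\<sigma> s, of_nat (wt m) / of_nat D, \<sigma> (dst m)) \<in> trans K"
      using m by (auto simp: trans_K)
    from wbs_dist_less(2)[OF st'(3) this] obtain p where p: "trans_seq K (\<sigma> t) p"
      "rel_dev (seq_weight p) (of_nat (wt m) / of_nat D) < r"
      "wbs_dist K (\<sigma> (dst m)) (seq_end (\<sigma> t) p) < r"
      "\<forall>u\<in>seq_inner p. wbs_dist K (\<sigma> s) u < r" by blast
    \<comment> \<open>Every state entered is the target of an edge, so it is named by a vertex below
      \<open>n\<close> even if \<open>K\<close> has other states.\<close>
    have "snd ` set q \<subseteq> \<sigma> ` {..<n}" if "trans_seq K a q" for a q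
      using that by (induction q arbitrary: a) (auto simp: trans_K dst_n)
    then have "seq_inner p \<subseteq> \<sigma> ` {..<n}"
      using p(1) by (fastforce simp: seq_inner_def dest: in_set_butlastD)
    then have "seq_inner p \<subseteq> \<sigma> ` (R `` {s})"
      using p(4) st' by (auto simp: R_def)
    from seq_imp_path[OF p(1) st'(2) this] obtain u v where uv: "u < n" "path (R `` {s}) t u v"
      "seq_end (\<sigma> t) p = \<sigma> u" "seq_weight p = of_nat v / of_nat D"
      by (auto simp: R_def)
    have "rel_dev (of_nat v / of_nat D) (of_nat (wt m) / of_nat D) \<le> ennreal (real k / real Q)"
      using p(2) uv(4) wt_dvd[OF m(1)] unfolding r_def by (intro rel_dev_less_imp D_pos Q_pos) auto
    then have "deviation v (wt m) * Q \<le> k * wt m"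
      using rel_dev_le_iff[OF D_pos Q_pos] by blast
    moreover have "(dst m, u) \<in> R"
      using p(3) uv dst_n[OF m(1)] by (simp add: R_def)
    ultimately show "\<exists>u v. path (R `` {s}) t u v \<and> (dst m, u) \<in> R \<and>
        deviation v (wt m) * Q \<le> k * wt m"
      using uv(2) by blast
  qed
  moreover have "R \<subseteq> {..<N} \<times> {..<N}" using n_le by (auto simp: R_def)
  moreover have "(i, j) \<in> R" using less ij by (auto simp: R_def r_def)
  ultimately show ?thesis by blast
qed

lemma wbs_dist_eq:
  assumes ij: "i < n" "j < n"
  defines "S \<equiv> \<lambda>k. \<exists>R. R \<subseteq> {..<N} \<times> {..<N} \<and> (i, j) \<in> R \<and> sim k Q R"
  shows "wbs_dist K (\<sigma> i) (\<sigma> j) = (if \<exists>k. S k then ennreal (real (LEAST k. S k) / real Q) else \<infinity>)"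
proof (cases "wbs_dist K (\<sigma> i) (\<sigma> j)")
  case (real x)
  \<comment> \<open>For a finite distance \<open>x\<close> this is the largest \<open>k\<close> with
    \<open>k / Q \<le> x\<close>. Then \<open>S k\<close> holds, so the least threshold gives a
    lower bound on \<open>x\<close>; being a threshold, it also gives an upper bound.\<close>
  define k where "k = nat \<lfloor>x * real Q\<rfloor>"
  have k: "real k \<le> x * real Q" "x * real Q < real (Suc k)"
    using real(1) unfolding k_def by (simp_all add: floor_le_iff) linarith+
  then have "S k"
    unfolding S_def using real Q_pos
    by (intro wbs_dist_less_imp_sim ij) (simp add: ennreal_less_iff field_simps)
  then have L: "S (LEAST k. S k)" "(LEAST k. S k) \<le> k"
    by (auto intro: LeastI Least_le)
  have "wbs_dist K (\<sigma> i) (\<sigma> j) \<le> ennreal (real (LEAST k. S k) / real Q)"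
    using L(1) sim_imp_wbs_dist_le[OF _ _ ij] unfolding S_def by blast
  moreover have "ennreal (real (LEAST k. S k) / real Q) \<le> wbs_dist K (\<sigma> i) (\<sigma> j)"
  proof -
    have "real (LEAST k. S k) \<le> x * real Q" using L(2) k(1) by linarith
    then have "real (LEAST k. S k) / real Q \<le> x" using Q_pos by (simp add: field_simps)
    then show ?thesis using real by (simp add: ennreal_leI)
  qed
  ultimately show ?thesis using \<open>S k\<close> by (auto intro: antisym)
next
  case top
  have "\<not> S k" for k
    using top sim_imp_wbs_dist_le[OF _ _ ij, of k] unfolding S_def by (auto simp: top_unique)
  then show ?thesis using top by simp
qed

end

section \<open>Graphs read off codes, and the computed function\<close>

text \<open>Any number \<open>x\<close> is read as the code of a graph. Every component of a code is bounded by the code,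
  so \<open>fact (Suc x)\<close> is a common denominator of the weights.\<close>

definition is_trans :: "nat \<Rightarrow> nat \<Rightarrow> bool" where
  "is_trans x m \<longleftrightarrow> ldrop m (psnd x) \<noteq> 0"

definition coded_src :: "nat \<Rightarrow> nat \<Rightarrow> nat" where
  "coded_src x m = pfst (lnth (psnd x) m)"

definition coded_wt :: "nat \<Rightarrow> nat \<Rightarrow> nat" where
  "coded_wt x m = pfst (psnd (lnth (psnd x) m)) *
     (fact (Suc x) div Suc (pfst (psnd (psnd (lnth (psnd x) m)))))"

definition coded_dst :: "nat \<Rightarrow> nat \<Rightarrow> nat" where
  "coded_dst x m = psnd (psnd (psnd (lnth (psnd x) m)))"

definition coded_lab :: "nat \<Rightarrow> nat \<Rightarrow> nat" where
  "coded_lab x i = lnth (pfst x) i"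

lemma is_trans_less: "is_trans x m \<Longrightarrow> m < Suc x"
  using length_le_list_encode[of "list_decode (psnd x)"] psnd_le[of x]
  by (simp add: is_trans_def ldrop_eq_0_iff)

lemma coded_le:
  "coded_src x m \<le> x" "coded_dst x m \<le> x" "coded_wt x m \<le> x * fact (Suc x)"
proof -
  let ?e = "lnth (psnd x) m"
  have e: "?e \<le> x" using lnth_le psnd_le le_trans by blast
  show "coded_src x m \<le> x"
    unfolding coded_src_def using e pfst_le le_trans by blast
  show "coded_dst x m \<le> x"
    unfolding coded_dst_def using e psnd_le le_trans by meson
  have "pfst (psnd ?e) \<le> x" using e psnd_le pfst_le le_trans by meson
  then show "coded_wt x m \<le> x * fact (Suc x)"
    unfolding coded_wt_def by (intro mult_mono div_le_dividend) auto
qed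

text \<open>The bounds hold for every \<open>x\<close>, whether or not it codes a structure, as is
  needed for a total function.\<close>

interpretation coded: weighted_graph "{m. is_trans x m}" "coded_src x" "coded_wt x" "coded_dst x"
  "coded_lab x" "Suc x" for x
proof
  show "finite {m. is_trans x m}"
    by (rule finite_subset[of _ "{..<Suc x}"]) (use is_trans_less in auto)
qed (use coded_le in \<open>auto simp: less_Suc_eq_le\<close>)

definition coded_sim :: "nat \<Rightarrow> nat \<Rightarrow> nat \<Rightarrow> nat \<Rightarrow> nat \<Rightarrow> nat \<Rightarrow> bool" where
  "coded_sim x = coded.decided_sim x (Suc x)"

lemma coded_sim_iff:
  "coded_sim x M k Q i j \<longleftrightarrow>
    (\<exists>R. R \<subseteq> {..<Suc x} \<times> {..<Suc x} \<and> (i, j) \<in> R \<and> coded.capped_sim x M k Q R)"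
  unfolding coded_sim_def by (rule coded.decided_sim_iff) (simp add: is_trans_less)

lemma computable_coded:
  assumes "computable k a" "computable k b"
  shows "decidable k (\<lambda>xs. is_trans (a xs) (b xs))"
    and "computable k (\<lambda>xs. coded_src (a xs) (b xs))"
    and "computable k (\<lambda>xs. coded_wt (a xs) (b xs))"
    and "computable k (\<lambda>xs. coded_dst (a xs) (b xs))"
    and "computable k (\<lambda>xs. coded_lab (a xs) (b xs))"
  unfolding is_trans_def coded_src_def coded_wt_def coded_dst_def coded_lab_def
  by (intro computable_intros computable_pfst computable_psnd computable_lnth computable_ldrop
      computable_div assms)+

lemma decidable_coded_sim:
  assumes "computable k a" "computable k b" "computable k c" "computable k d" "computable k e"
    "computable k f"
  shows "decidable k (\<lambda>xs. coded_sim (a xs) (b xs) (c xs) (d xs) (e xs) (f xs))"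
proof -
  \<comment> \<open>Unfolded, the predicate has only bounded quantifiers over computable terms. It
    is treated on plain coordinates first; arbitrary arguments enter by composition.\<close>
  have "decidable 6 (\<lambda>xs. coded_sim (xs ! 0) (xs ! 1) (xs ! 2) (xs ! 3) (xs ! 4) (xs ! 5))"
    unfolding coded_sim_def coded.decided_sim_def coded.capped_path_def coded.closed_config_def
      mem_Collect_eq deviation_def min_def
    by (intro computable_intros decidable_holds computable_coded; simp)
  then show ?thesis
    using computable_comp[of "[a, b, c, d, e, f]"
        "\<lambda>xs. of_bool (coded_sim (xs ! 0) (xs ! 1) (xs ! 2) (xs ! 3) (xs ! 4) (xs ! 5))" k] assms
    by (simp add: decidable_def eval_nat_numeral)
qed

text \<open>\<open>(Suc k * (x * D)) + 1\<close> exceeds every weight that can match within \<open>k / Q\<close>, so capping there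
  is harmless.\<close>

definition sim_within :: "nat \<Rightarrow> nat \<Rightarrow> nat \<Rightarrow> nat \<Rightarrow> bool" where
  "sim_within x i j k \<longleftrightarrow>
     coded_sim x (Suc (Suc k * (x * fact (Suc x)))) k (fact (x * fact (Suc x))) i j"

lemma sim_within_iff:
  "sim_within x i j k \<longleftrightarrow> (\<exists>R. R \<subseteq> {..<Suc x} \<times> {..<Suc x} \<and> (i, j) \<in> R \<and>
    coded.sim x k (fact (x * fact (Suc x))) R)"
proof -
  have "Suc k * coded_wt x m < Suc (Suc k * (x * fact (Suc x)))" for m
    using coded_le(3)[of x m] by (intro le_imp_less_Suc mult_le_mono2)
  then have "coded.sim x k (fact (x * fact (Suc x))) R \<longleftrightarrow>
      coded.capped_sim x (Suc (Suc k * (x * fact (Suc x)))) k (fact (x * fact (Suc x))) R" for R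
    by (intro coded.sim_iff_capped_sim) auto
  then show ?thesis by (simp only: sim_within_def coded_sim_iff)
qed

text \<open>The quantifiers over \<open>k\<close> and \<open>R\<close> commute, and for a fixed
  finite \<open>R\<close> the existence of \<open>k\<close> is the question capped at
  \<open>1\<close>.\<close>

lemma ex_sim_within_iff: "(\<exists>k. sim_within x i j k) \<longleftrightarrow> coded_sim x 1 1 1 i j"
proof -
  have "(\<exists>k. coded.sim x k (fact (x * fact (Suc x))) R) \<longleftrightarrow> coded.capped_sim x 1 1 1 R"
    if "R \<subseteq> {..<Suc x} \<times> {..<Suc x}" for R
    by (rule coded.ex_sim_iff) (use that finite_subset in auto)
  then show ?thesis unfolding sim_within_iff coded_sim_iff by blast
qed

text \<open>The negated disjunct lets the search stop at \<open>0\<close> when no threshold exists,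
  so minimization is total. In a value code \<open>0\<close> is \<open>\<infinity>\<close> and
  denominators are stored minus one, hence \<open>Suc\<close> and \<open>- 1\<close>.\<close>

definition dist_code :: "nat \<Rightarrow> nat \<Rightarrow> nat \<Rightarrow> nat" where
  "dist_code x i j =
     (if coded_sim x 1 1 1 i j
      then Suc (prod_encode (LEAST k. \<not> coded_sim x 1 1 1 i j \<or> sim_within x i j k,
        fact (x * fact (Suc x)) - 1))
      else 0)"

lemma decidable_sim_within:
  assumes "computable k a" "computable k b" "computable k c" "computable k d"
  shows "decidable k (\<lambda>xs. sim_within (a xs) (b xs) (c xs) (d xs))"
  unfolding sim_within_def by (intro decidable_coded_sim computable_intros assms)

lemma computable_dist_code: "computable 3 (\<lambda>xs. dist_code (xs ! 0) (xs ! 1) (xs ! 2))"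
proof -
  have "\<exists>k. \<not> coded_sim x 1 1 1 i j \<or> sim_within x i j k" for x i j
    using ex_sim_within_iff by blast
  then show ?thesis
    unfolding dist_code_def
    by (intro computable_intros computable_prod_encode decidable_coded_sim decidable_sim_within
        computable_LEAST) simp_all
qed

text \<open>Lengths and components of a list are bounded by its code, which bounds states and
  denominators. A positive scaled weight is at most \<open>x * fact (Suc x)\<close> and so divides
  the factorial of that number.\<close>

lemma presented_wks_code:
  assumes K: "is_wks K" "presents xs ls ts K"
  defines "x \<equiv> wks_code ls ts"
  shows "presented_wks {m. is_trans x m} (coded_src x) (coded_wt x) (coded_dst x) (coded_lab x)
    (Suc x) K ((!) xs) (length xs) (fact (Suc x)) (fact (x * fact (Suc x)))"
proof -
  define es where "es = map (\<lambda>(i, a, b, j). prod_encode (i, prod_encode (a, prod_encode (b, j)))) ts"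
  have x: "pfst x = list_encode ls" "psnd x = list_encode es"
    by (simp_all add: x_def wks_code_def es_def)
  have T: "is_trans x m \<longleftrightarrow> m < length ts" for m
    by (simp add: is_trans_def ldrop_eq_0_iff x not_le) (simp add: es_def)
  have tr: "coded_src x m = i \<and> coded_dst x m = j \<and> coded_wt x m = a * (fact (Suc x) div Suc b) \<and> b \<le> x"
    if "m < length ts" "ts ! m = (i, a, b, j)" for m i a b j
  proof -
    have e: "lnth (psnd x) m = prod_encode (i, prod_encode (a, prod_encode (b, j)))"
      using that by (simp add: x lnth_list_encode es_def)
    have "pfst (psnd (psnd (lnth (psnd x) m))) \<le> x"
      using pfst_le psnd_le lnth_le le_trans by meson
    with e show ?thesis by (simp add: coded_src_def coded_dst_def coded_wt_def del: fact_Suc)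
  qed
  \<comment> \<open>As \<open>b \<le> x\<close>, \<open>Suc b\<close> divides
    \<open>fact (Suc x)\<close>, so the integer division in \<open>coded_wt\<close> is
    exact.\<close>
  have wt: "of_nat (a * (fact (Suc x) div Suc b)) / of_nat (fact (Suc x)) =
      (of_nat a / of_nat (Suc b) :: rat)" if b: "b \<le> x" for a b
  proof -
    have "Suc b dvd (fact (Suc x) :: nat)" using b by (intro dvd_fact) auto
    then obtain c :: nat where c: "fact (Suc x) = Suc b * c" ..
    then have "c \<noteq> 0" using fact_nonzero[of "Suc x", where 'a = nat] by auto
    moreover have "Suc b * c div Suc b = c" by (rule nonzero_mult_div_cancel_left) simp
    ultimately show ?thesis unfolding c of_nat_mult by (simp only: of_nat_mult) simp
  qed
  note P = K(2)[unfolded presents_def]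
  show ?thesis
  proof unfold_locales
    show "inj_on ((!) xs) {..<length xs}"
      using P by (auto simp: inj_on_def nth_eq_iff_index_eq)
    show "length xs \<le> Suc x"
      using P length_le_list_encode[of ls] pfst_le[of x] by (simp add: x)
    show "coded_src x m < length xs" "coded_dst x m < length xs" if "m \<in> {m. is_trans x m}" for m
    proof -
      obtain i a b j where m: "ts ! m = (i, a, b, j)" by (cases "ts ! m")
      then have "(i, a, b, j) \<in> set ts" using that T by (metis mem_Collect_eq nth_mem)
      then show "coded_src x m < length xs" "coded_dst x m < length xs"
        using tr[OF _ m] that T P by auto
    qed
    show "trans K = (\<lambda>m. (xs ! coded_src x m, of_nat (coded_wt x m) / of_nat (fact (Suc x)),
        xs ! coded_dst x m)) ` {m. is_trans x m}"
    proof -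
      have "set ts = (!) ts ` {m. is_trans x m}"
        by (auto simp: T set_conv_nth)
      then have "trans K = (\<lambda>m. case ts ! m of (i, a, b, j) \<Rightarrow>
          (xs ! i, of_nat a / of_nat (Suc b), xs ! j)) ` {m. is_trans x m}"
        using P by (simp add: image_image)
      also have "\<dots> = (\<lambda>m. (xs ! coded_src x m, of_nat (coded_wt x m) / of_nat (fact (Suc x)),
          xs ! coded_dst x m)) ` {m. is_trans x m}"
      proof (rule image_cong[OF refl])
        fix m assume "m \<in> {m. is_trans x m}"
        then have m: "m < length ts" by (simp add: T)
        obtain i a b j where e: "ts ! m = (i, a, b, j)" by (cases "ts ! m")
        show "(case ts ! m of (i, a, b, j) \<Rightarrow> (xs ! i, of_nat a / of_nat (Suc b) :: rat, xs ! j)) =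
          (xs ! coded_src x m, of_nat (coded_wt x m) / of_nat (fact (Suc x)), xs ! coded_dst x m)"
          using tr[OF m e] wt[of b a] by (simp only: e prod.case)
      qed
      finally show ?thesis .
    qed
    show "coded_lab x i = coded_lab x j \<longleftrightarrow> label K (xs ! i) = label K (xs ! j)"
      if "i < length xs" "j < length xs" for i j
      using P that by (simp add: coded_lab_def x lnth_list_encode)
    show "coded_wt x m dvd fact (x * fact (Suc x))" if "0 < coded_wt x m" for m
      using that coded_le(3)[of x m] by (intro dvd_fact) auto
  qed auto
qed

theorem theorem2:
  shows "\<exists>f. recursive 3 f \<and>
    (\<forall>(K :: ('s, 'p) wks) xs ls ts i j.
       is_wks K \<and> presents xs ls ts K \<and> i < length xs \<and> j < length xs \<longrightarrow>
       code_value (f [wks_code ls ts, i, j]) = wbs_dist K (xs ! i) (xs ! j))"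
proof -
  obtain f where f: "recursive 3 f"
    "\<And>xs. length xs = 3 \<Longrightarrow> f xs = dist_code (xs ! 0) (xs ! 1) (xs ! 2)"
    using computable_dist_code unfolding computable_def by blast
  have "code_value (dist_code (wks_code ls ts) i j) = wbs_dist K (xs ! i) (xs ! j)"
    if K: "is_wks K" "presents xs ls ts K" and ij: "i < length xs" "j < length xs"
    for K :: "('s, 'p) wks" and xs ls ts i j
  proof -
    define x where "x = wks_code ls ts"
    interpret presented_wks "{m. is_trans x m}" "coded_src x" "coded_wt x" "coded_dst x"
      "coded_lab x" "Suc x" K "(!) xs" "length xs" "fact (Suc x)" "fact (x * fact (Suc x))"
      unfolding x_def by (rule presented_wks_code[OF K])
    have "wbs_dist K (xs ! i) (xs ! j) =
        (if coded_sim x 1 1 1 i j then ennreal (real (LEAST k. sim_within x i j k) /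
           real (fact (x * fact (Suc x)))) else \<infinity>)"
      using wbs_dist_eq[OF ij] by (simp only: sim_within_iff[symmetric] ex_sim_within_iff)
    \<comment> \<open>When the guard holds, the negated disjunct in the search is false, and
      positivity of \<open>Q\<close> restores the denominator from \<open>Q - 1\<close>.\<close>
    then show ?thesis
      unfolding x_def[symmetric] dist_code_def code_value_def using Q_pos
      by (cases "coded_sim x 1 1 1 i j") (simp_all del: One_nat_def fact_Suc)
  qed
  then show ?thesis using f by (intro exI[of _ f]) simp
qed

end
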